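(* Let $G\in\mathscr{B}$ with $\operatorname{diam}(G)\ge 4$. Then the eigenvalues of $E(G)$ are symmetric with respect to the origin (i.e. for every real $\mu$, $\mu$ and $-\mu$ are eigenvalues of $E(G)$ with the same multiplicity) if and only if $\operatorname{diam}(G)$ is odd.
   Context: All graphs are finite, simple and connected; $d(u,v)$ is the distance in $G$, $e(u)=\max_v d(u,v)$, $\operatorname{diam}(G)=\max_u e(u)$. The eccentricity matrix $E(G)$ (vertices $v_1,\dots,v_n$) is the $n\times n$ matrix with $(i,j)$ entry $d(v_i,v_j)$ if $d(v_i,v_j)=\min\{e(v_i),e(v_j)\}$ and $0$ otherwise. A block is a maximal connected subgraph without a cut-vertex. A bi-block graph is a connected graph all of whose blocks are complete bipartite graphs. $\mathscr{B}$ is the class of bi-block graphs with at least two blocks in which every block contains at most two cut-vertices of $G$. *)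

theory Defs
  imports "Graph_Theory.Graph_Theory" "Jordan_Normal_Form.Char_Poly"
begin

text \<open>
  Finite simple graphs are the symmetric digraphs of locale \<open>graph\<close>: an undirected edge is a pair
  of opposite arcs. The strongly connected components of such a digraph are its connected components.
\<close>

definition gdist :: "('a, 'b) pre_digraph \<Rightarrow> 'a \<Rightarrow> 'a \<Rightarrow> nat" where
  "gdist G u v = Inf (length ` {p. pre_digraph.awalk G u p v})"

lemma (in wf_digraph) gdist_eq_\<mu>:
  assumes "u \<rightarrow>\<^sup>* v"
  shows "\<mu> (\<lambda>_. 1) u v = ereal (real (gdist G u v))"
proof -
  let ?W = "{p. awalk u p v}"
  have ne: "length ` ?W \<noteq> {}" using assms by (auto simp: reachable_awalk)
  have cost: "awalk_cost (\<lambda>_. 1) p = real (length p)" for p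
    by (induct p) auto
  have "gdist G u v \<in> length ` ?W"
    unfolding gdist_def by (rule Inf_nat_def1[OF ne])
  then obtain p where p: "awalk u p v" "length p = gdist G u v" by auto
  have le: "gdist G u v \<le> length q" if "awalk u q v" for q
    unfolding gdist_def using that by (intro cInf_lower) auto
  show ?thesis
  proof (rule antisym)
    show "\<mu> (\<lambda>_. 1) u v \<le> ereal (real (gdist G u v))"
      using min_cost_le_walk_cost[OF p(1), of "\<lambda>_. 1"] p(2) by (simp add: cost)
    show "ereal (real (gdist G u v)) \<le> \<mu> (\<lambda>_. 1) u v"
      unfolding \<mu>_def using le by (auto intro!: INF_greatest simp: cost)
  qed
qed

definition eccentricity :: "('a, 'b) pre_digraph \<Rightarrow> 'a \<Rightarrow> nat" where
  "eccentricity G u = Max (gdist G u ` verts G)"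

definition diam :: "('a, 'b) pre_digraph \<Rightarrow> nat" where
  "diam G = Max (eccentricity G ` verts G)"

text \<open>The list \<open>vs\<close> is the chosen ordering of the vertices.\<close>

definition ecc_matrix :: "('a, 'b) pre_digraph \<Rightarrow> 'a list \<Rightarrow> real mat" where
  "ecc_matrix G vs = mat (length vs) (length vs) (\<lambda>(i, j).
     if gdist G (vs ! i) (vs ! j) = min (eccentricity G (vs ! i)) (eccentricity G (vs ! j))
     then real (gdist G (vs ! i) (vs ! j)) else 0)"

text \<open>Counting components makes the vertex of the one-vertex graph not a cut-vertex.\<close>

definition cut_vertex :: "('a, 'b) pre_digraph \<Rightarrow> 'a \<Rightarrow> bool" where
  "cut_vertex G v \<longleftrightarrow> v \<in> verts G \<and>
     card (pre_digraph.sccs_verts (pre_digraph.del_vert G v)) > card (pre_digraph.sccs_verts G)"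

definition is_block :: "('a, 'b) pre_digraph \<Rightarrow> ('a, 'b) pre_digraph \<Rightarrow> bool" where
  "is_block G B \<longleftrightarrow> pre_digraph.max_subgraph G
     (\<lambda>H. graph H \<and> Digraph_Component.connected H \<and> (\<forall>v. \<not> cut_vertex H v)) B"

definition bi_block_graph :: "('a, 'b) pre_digraph \<Rightarrow> bool" where
  "bi_block_graph G \<longleftrightarrow> graph G \<and> Digraph_Component.connected G \<and>
     (\<forall>B. is_block G B \<longrightarrow> (\<exists>m\<ge>1. \<exists>n\<ge>1. complete_bipartite_digraph m n B))"

text \<open>The class \<open>\<B>\<close>; the cut-vertices counted in a block are those of the whole graph.\<close>

definition class_B :: "('a, 'b) pre_digraph \<Rightarrow> bool" where
  "class_B G \<longleftrightarrow> bi_block_graph G \<and> card {B. is_block G B} \<ge> 2 \<and>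
     (\<forall>B. is_block G B \<longrightarrow> card {v \<in> verts B. cut_vertex G v} \<le> 2)"

text \<open>The multiplicity of an eigenvalue is its multiplicity as a root of the characteristic
  polynomial (zero for non-eigenvalues).\<close>

definition eigenvalues_symmetric :: "real mat \<Rightarrow> bool" where
  "eigenvalues_symmetric A \<longleftrightarrow>
     (\<forall>\<mu>. Polynomial.order \<mu> (char_poly A) = Polynomial.order (- \<mu>) (char_poly A))"

end

theory Submission
  imports Defs "Jordan_Normal_Form.Schur_Decomposition"
begin

text \<open>
  Each vertex \<open>w\<close> reaches a block \<open>B\<close> through a unique gate, which is a cut-vertex if \<open>w\<close> is outside
  \<open>B\<close>; distances between vertices with different gates add up along the gates. Apply this to the
  block \<open>B\<close> in the middle of a diametral path. If the diameter is \<open>2 r\<close>, the middle vertex has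
  eccentricity \<open>r\<close>, so it forms with the two ends of the path a triangle of positive entries of the
  eccentricity matrix \<open>E\<close>. Hence \<open>E\<^sup>3\<close> has positive trace, whereas a symmetric spectrum would make the
  sum of the cubes of the eigenvalues vanish. If the diameter is odd, then \<open>B\<close> has exactly two
  gates, and estimating eccentricities from below by the distances to the ends of the path shows that
  the nonzero entries of \<open>E\<close> join two complementary vertex sets. Hence \<open>E\<close> is similar to \<open>- E\<close>.
\<close>

section \<open>Gates of blocks\<close>

text \<open>Works with an arc relation and a vertex set, so that deleting vertices only changes
  \<open>S\<close>. The empty set counts as connected.\<close>

definition connected_on :: "('a \<times> 'a) set \<Rightarrow> 'a set \<Rightarrow> bool" where
  "connected_on R S \<longleftrightarrow> (\<forall>a\<in>S. \<forall>b\<in>S. (a, b) \<in> (Restr R S)\<^sup>*)"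

text \<open>For nonempty \<open>S\<close> this means connected without a cut-vertex. Single vertices
  qualify because the empty set is connected.\<close>

definition nonseparable :: "('a \<times> 'a) set \<Rightarrow> 'a set \<Rightarrow> bool" where
  "nonseparable R S \<longleftrightarrow> connected_on R S \<and> (\<forall>v. connected_on R (S - {v}))"

definition rel_dist :: "('a \<times> 'a) set \<Rightarrow> 'a \<Rightarrow> 'a \<Rightarrow> nat" where
  "rel_dist R u v = (LEAST n. (u, v) \<in> R ^^ n)"

section \<open>Reachability inside vertex sets, paths and ears\<close>

lemma sym_Restr: "sym R \<Longrightarrow> sym (Restr R S)"
  by (auto simp: sym_def)

lemma rtrancl_symD: "sym R \<Longrightarrow> (a, b) \<in> R\<^sup>* \<Longrightarrow> (b, a) \<in> R\<^sup>*"
  by (meson sym_rtrancl symD)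

lemma Restr_rtrancl_mono:
  assumes "(a, b) \<in> (Restr R S)\<^sup>*" "S \<subseteq> T"
  shows "(a, b) \<in> (Restr R T)\<^sup>*"
  using assms rtrancl_mono[of "Restr R S" "Restr R T"] by blast

lemma connected_onI_root:
  assumes "sym R" and "\<And>a. a \<in> S \<Longrightarrow> (a, r) \<in> (Restr R S)\<^sup>*"
  shows "connected_on R S"
  unfolding connected_on_def
proof (intro ballI)
  fix a b assume ab: "a \<in> S" "b \<in> S"
  have "(r, b) \<in> (Restr R S)\<^sup>*"
    using rtrancl_symD[OF sym_Restr[OF assms(1)] assms(2)[OF ab(2)]] .
  then show "(a, b) \<in> (Restr R S)\<^sup>*" using assms(2)[OF ab(1)] by (rule rtrancl_trans[rotated])
qed

lemma connected_on_Restr: "connected_on (Restr R S) S \<longleftrightarrow> connected_on R S"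
  by (simp add: connected_on_def)

lemma connected_on_mono:
  assumes "connected_on R S" "R \<subseteq> R'"
  shows "connected_on R' S"
proof -
  have "(Restr R S)\<^sup>* \<subseteq> (Restr R' S)\<^sup>*" using assms(2) by (intro rtrancl_mono) auto
  then show ?thesis using assms(1) by (auto simp: connected_on_def)
qed

lemma nonseparable_mono: "nonseparable R S \<Longrightarrow> R \<subseteq> R' \<Longrightarrow> nonseparable R' S"
  using connected_on_mono unfolding nonseparable_def by blast

lemma nonseparable_Restr: "nonseparable (Restr R S) S \<longleftrightarrow> nonseparable R S"
proof -
  have "connected_on (Restr R S) (S - X) = connected_on R (S - X)" for X
  proof -
    have "Restr (Restr R S) (S - X) = Restr R (S - X)" by auto
    then show ?thesis by (simp add: connected_on_def)
  qed
  from this[of "{}"] this show ?thesis by (simp add: nonseparable_def)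
qed

text \<open>The path is grown backwards from \<open>b\<close>. If the new vertex \<open>a\<close>
  already lies on it, everything before that occurrence is discarded.\<close>

lemma rtrancl_imp_distinct_path:
  assumes "(a, b) \<in> R\<^sup>*"
  shows "\<exists>xs. xs \<noteq> [] \<and> hd xs = a \<and> last xs = b \<and> distinct xs \<and> successively (\<lambda>x y. (x, y) \<in> R) xs"
  using assms
proof (induction rule: converse_rtrancl_induct)
  case base
  show ?case by (intro exI[of _ "[b]"]) simp
next
  case (step a c)
  then obtain xs where xs: "xs \<noteq> []" "hd xs = c" "last xs = b" "distinct xs"
    "successively (\<lambda>x y. (x, y) \<in> R) xs" by blast
  show ?case
  proof (cases "a \<in> set xs")
    case False
    then show ?thesis using xs step(1)
      by (intro exI[of _ "a # xs"]) (auto simp: successively_Cons)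
  next
    case True
    then obtain ys zs where "xs = ys @ a # zs" by (meson split_list)
    then show ?thesis using xs
      by (intro exI[of _ "a # zs"]) (auto simp: successively_append_iff)
  qed
qed

lemma successively_rtrancl_hd:
  assumes "successively (\<lambda>x y. (x, y) \<in> R) xs" "x \<in> set xs" "set xs \<subseteq> S"
  shows "(hd xs, x) \<in> (Restr R S)\<^sup>*"
  using assms
proof (induction xs)
  case (Cons a xs)
  show ?case
  proof (cases "x = a")
    case False
    then have x: "x \<in> set xs" "xs \<noteq> []" using Cons.prems by auto
    then have "(a, hd xs) \<in> Restr R S" using Cons.prems by (auto simp: successively_Cons)
    moreover have "(hd xs, x) \<in> (Restr R S)\<^sup>*"
      using Cons x by (auto simp: successively_Cons)
    ultimately show ?thesis by (metis converse_rtrancl_into_rtrancl list.sel(1))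
  qed simp
qed simp

lemma successively_rtrancl_last:
  assumes "successively (\<lambda>x y. (x, y) \<in> R) xs" "x \<in> set xs" "set xs \<subseteq> S"
  shows "(x, last xs) \<in> (Restr R S)\<^sup>*"
  using assms
proof (induction xs)
  case (Cons a xs)
  show ?case
  proof (cases "x \<in> set xs")
    case True
    then have "xs \<noteq> []" by auto
    with Cons True show ?thesis by (auto simp: successively_Cons)
  next
    case False
    then have [simp]: "x = a" using Cons.prems by auto
    show ?thesis
    proof (cases "xs = []")
      case ne: False
      then have "(a, hd xs) \<in> Restr R S" using Cons.prems by (auto simp: successively_Cons)
      moreover have "(hd xs, last xs) \<in> (Restr R S)\<^sup>*"
        using Cons.prems ne successively_rtrancl_hd[of R xs "last xs" S]
        by (auto simp: successively_Cons)
      ultimately show ?thesis using ne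
        by (metis converse_rtrancl_into_rtrancl last_ConsR \<open>x = a\<close>)
    qed simp
  qed
qed simp

text \<open>After deleting at most one vertex, at least one of \<open>p\<close>, \<open>q\<close>
  survives, and each remaining ear vertex still reaches a surviving one along the ear. The rest of
  \<open>B\<close> is connected by assumption.\<close>

lemma nonseparable_add_ear:
  assumes B: "nonseparable R B" and "sym R"
    and pq: "p \<in> B" "q \<in> B" "p \<noteq> q"
    and xs: "xs \<noteq> []" "distinct xs" "successively (\<lambda>x y. (x, y) \<in> R) xs" "set xs \<inter> B = {}"
    and ends: "(hd xs, p) \<in> R" "(last xs, q) \<in> R"
  shows "nonseparable R (B \<union> set xs)"
proof -
  have "connected_on R ((B \<union> set xs) - X)"
    if X: "X = {} \<or> X = {v}" for X v
  proof -
    let ?S = "(B \<union> set xs) - X"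
    have BX: "connected_on R (B - X)" using B X by (auto simp: nonseparable_def)
    \<comment> \<open>A surviving end of the ear serves as the root to which all other vertices are
      joined.\<close>
    obtain r where r: "r \<in> B - X" "r \<in> {p, q}" using pq X by auto
    have in_B: "(b, r) \<in> (Restr R ?S)\<^sup>*" if "b \<in> B - X" for b
    proof -
      have "(b, r) \<in> (Restr R (B - X))\<^sup>*" using BX r that by (auto simp: connected_on_def)
      then show ?thesis by (rule Restr_rtrancl_mono) auto
    qed
    have to_p: "(x, r) \<in> (Restr R ?S)\<^sup>*"
      if "successively (\<lambda>x y. (x, y) \<in> R) ys" "x \<in> set ys" "set ys \<subseteq> set xs - X"
         "hd ys = hd xs" "p \<notin> X" for x ys
    proof -
      have "(hd ys, x) \<in> (Restr R ?S)\<^sup>*"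
        using that by (intro successively_rtrancl_hd) auto
      then have "(x, hd ys) \<in> (Restr R ?S)\<^sup>*"
        by (rule rtrancl_symD[OF sym_Restr[OF \<open>sym R\<close>]])
      moreover have "hd ys \<in> set ys" using that by (intro hd_in_set) auto
      then have "(hd ys, p) \<in> Restr R ?S" using that ends pq by auto
      ultimately show ?thesis using in_B[of p] that pq
        by (metis DiffI rtrancl.rtrancl_into_rtrancl rtrancl_trans)
    qed
    have to_q: "(x, r) \<in> (Restr R ?S)\<^sup>*"
      if "successively (\<lambda>x y. (x, y) \<in> R) ys" "x \<in> set ys" "set ys \<subseteq> set xs - X"
         "last ys = last xs" "q \<notin> X" for x ys
    proof -
      have "(x, last ys) \<in> (Restr R ?S)\<^sup>*"
        using that by (intro successively_rtrancl_last) auto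
      moreover have "last ys \<in> set ys" using that by (intro last_in_set) auto
      then have "(last ys, q) \<in> Restr R ?S" using that ends pq by auto
      ultimately show ?thesis using in_B[of q] that pq
        by (metis DiffI rtrancl.rtrancl_into_rtrancl rtrancl_trans)
    qed
    show ?thesis
    proof (rule connected_onI_root[OF \<open>sym R\<close>])
      fix a assume a: "a \<in> ?S"
      show "(a, r) \<in> (Restr R ?S)\<^sup>*"
      proof (cases "a \<in> B")
        case True
        then show ?thesis using in_B a by auto
      next
        case False
        then have ax: "a \<in> set xs" using a by auto
        show ?thesis
        proof (cases "X \<inter> set xs = {}")
          case True
          have "p \<notin> X \<or> q \<notin> X" using X pq by auto
          then show ?thesis
            using to_p[of xs a] to_q[of xs a] ax True xs by blast
        next
          case False
          then have v: "v \<in> set xs" "X = {v}" using X by auto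
          \<comment> \<open>The deleted vertex cuts the ear into \<open>ys\<close>, still attached
            to \<open>p\<close>, and \<open>zs\<close>, still attached to \<open>q\<close>. Neither
            \<open>p\<close> nor \<open>q\<close> is deleted here.\<close>
          then obtain ys zs where s: "xs = ys @ v # zs" by (meson split_list)
          have pqX: "p \<notin> X" "q \<notin> X" using v xs pq by auto
          have d: "v \<notin> set ys" "v \<notin> set zs" using xs s by auto
          show ?thesis
          proof (cases "a \<in> set ys")
            case True
            then have "hd ys = hd xs" "successively (\<lambda>x y. (x, y) \<in> R) ys"
              using s xs(3) by (auto simp: hd_append successively_append_iff)
            moreover have "set ys \<subseteq> set xs - X" using s d v by auto
            ultimately show ?thesis using to_p True pqX by blast
          next
            case False
            then have "a \<in> set zs" using ax a s v by auto
            then have "last zs = last xs" "successively (\<lambda>x y. (x, y) \<in> R) zs"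
              using s xs(3) by (auto simp: successively_append_iff successively_Cons)
            moreover have "set zs \<subseteq> set xs - X" using s d v by auto
            ultimately show ?thesis using to_q \<open>a \<in> set zs\<close> pqX by blast
          qed
        qed
      qed
    qed
  qed
  from this[of "{}"] this[of "{v}" v for v] show ?thesis
    by (auto simp: nonseparable_def)
qed

section \<open>The path metric of a connected symmetric relation\<close>

locale connected_rel =
  fixes V :: "'a set" and R :: "('a \<times> 'a) set"
  assumes finite_V: "finite V"
    and R_sub: "R \<subseteq> V \<times> V"
    and sym_R: "sym R"
    and irrefl_R: "(x, x) \<notin> R"
    and conn: "connected_on R V"
begin

abbreviation d where "d \<equiv> rel_dist R"

lemma reach: "u \<in> V \<Longrightarrow> v \<in> V \<Longrightarrow> (u, v) \<in> R\<^sup>*"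
  using conn R_sub by (auto simp: connected_on_def Int_absorb2)

lemma dist_attained: "u \<in> V \<Longrightarrow> v \<in> V \<Longrightarrow> (u, v) \<in> R ^^ d u v"
  unfolding rel_dist_def
  by (rule LeastI_ex) (use reach in \<open>auto simp: rtrancl_power\<close>)

lemma dist_le: "(u, v) \<in> R ^^ n \<Longrightarrow> d u v \<le> n"
  unfolding rel_dist_def by (rule Least_le)

lemma relpow_sym: "(u, v) \<in> R ^^ n \<Longrightarrow> (v, u) \<in> R ^^ n"
proof (induction n arbitrary: v)
  case (Suc n)
  then obtain w where w: "(u, w) \<in> R ^^ n" "(w, v) \<in> R" by auto
  then have "(v, w) \<in> R" using sym_R by (auto dest: symD)
  then show ?case using Suc.IH[OF w(1)] by (rule relpow_Suc_I2)
qed auto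

lemma dist_commute: "u \<in> V \<Longrightarrow> v \<in> V \<Longrightarrow> d u v = d v u"
  by (rule antisym; rule dist_le, rule relpow_sym, rule dist_attained)

lemma dist_triangle:
  assumes "u \<in> V" "v \<in> V" "w \<in> V" shows "d u w \<le> d u v + d v w"
  using dist_attained[OF assms(1,2)] dist_attained[OF assms(2,3)]
  by (intro dist_le) (auto simp: relpow_add)

lemma dist_self [simp]: "d u u = 0"
  using dist_le[of u u 0] by simp

lemma dist_eq_0: "u \<in> V \<Longrightarrow> v \<in> V \<Longrightarrow> d u v = 0 \<longleftrightarrow> u = v"
  using dist_attained[of u v] by auto

lemma dist_eq_1: "u \<in> V \<Longrightarrow> v \<in> V \<Longrightarrow> d u v = 1 \<longleftrightarrow> (u, v) \<in> R"
proof
  assume uv: "u \<in> V" "v \<in> V"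
  show "(u, v) \<in> R" if "d u v = 1" using that dist_attained[OF uv] by auto
  show "d u v = 1" if "(u, v) \<in> R"
    using that dist_le[of u v 1] dist_eq_0[OF uv] irrefl_R by (cases "d u v") auto
qed

text \<open>Cut a shortest walk after \<open>k\<close> steps; the triangle inequality forces both
  pieces to be shortest.\<close>

lemma dist_split:
  assumes "u \<in> V" "v \<in> V" "k \<le> d u v"
  shows "\<exists>x\<in>V. d u x = k \<and> d x v = d u v - k"
proof -
  obtain m where m: "d u v = k + m" using assms le_Suc_ex by blast
  then obtain x where x: "(u, x) \<in> R ^^ k" "(x, v) \<in> R ^^ m"
    using dist_attained[OF assms(1,2)] by (auto simp: relpow_add)
  have "x \<in> V" using x assms R_sub by (cases k) auto
  then show ?thesis
    using dist_le[OF x(1)] dist_le[OF x(2)] dist_triangle[OF assms(1) \<open>x \<in> V\<close> assms(2)] m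
    by (intro bexI[of _ x]) auto
qed

text \<open>Blocks as vertex sets; \<open>is_block_induce\<close> shows that the induced subgraphs
  are blocks of the graph.\<close>

definition is_max_nonsep :: "'a set \<Rightarrow> bool" where
  "is_max_nonsep B \<longleftrightarrow> B \<noteq> {} \<and> B \<subseteq> V \<and> nonseparable R B \<and>
     (\<forall>T. B \<subseteq> T \<and> T \<subseteq> V \<and> nonseparable R T \<longrightarrow> T = B)"

text \<open>The vertex at which a walk from \<open>w\<close> first meets \<open>B\<close>; it does not depend on the walk, because
  two different entry points would yield an ear enlarging the block.\<close>

definition gate :: "'a set \<Rightarrow> 'a \<Rightarrow> 'a" where
  "gate B w = (SOME p. p \<in> B \<and> (w, p) \<in> {(a, b) \<in> R. a \<notin> B}\<^sup>*)"

context
  fixes B assumes B: "is_max_nonsep B"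
begin

text \<open>No step starts in \<open>B\<close>, so a walk along \<open>R'\<close> stops as soon as
  it enters \<open>B\<close>.\<close>

abbreviation (input) "R' \<equiv> {(a, b) \<in> R. a \<notin> B}"

text \<open>Here \<open>s\<close> is the last vertex of the walk before it enters \<open>B\<close>
  at \<open>p\<close>.\<close>

lemma outer_path:
  assumes "(w, p) \<in> R'\<^sup>*" "w \<notin> B" "p \<in> B" "w \<in> V"
  shows "\<exists>s. (w, s) \<in> (Restr R (V - B))\<^sup>* \<and> s \<in> V - B \<and> (s, p) \<in> R"
  using assms
proof (induction rule: converse_rtrancl_induct)
  case (step w z)
  have z: "(w, z) \<in> R" "z \<in> V" using step R_sub by auto
  show ?case
  proof (cases "z \<in> B")
    case True
    then have "z = p" using step(2) by (auto elim: converse_rtranclE)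
    then show ?thesis using step z by blast
  next
    case False
    then obtain s where "(z, s) \<in> (Restr R (V - B))\<^sup>*" "s \<in> V - B" "(s, p) \<in> R"
      using step z by auto
    moreover have "(w, z) \<in> Restr R (V - B)" using z False step by auto
    ultimately show ?thesis by (meson converse_rtrancl_into_rtrancl)
  qed
qed auto

text \<open>Both walks start at \<open>w\<close>, so the last outer vertices \<open>s\<close> and
  \<open>t\<close> are joined by a path outside \<open>B\<close>. For \<open>p\<close> different
  from \<open>q\<close> this path is an ear, against the maximality of \<open>B\<close>.\<close>

lemma outer_path_unique:
  assumes p: "(w, p) \<in> R'\<^sup>*" "p \<in> B" and q: "(w, q) \<in> R'\<^sup>*" "q \<in> B" and w: "w \<in> V"
  shows "p = q"
proof (cases "w \<in> B")
  case True
  then show ?thesis using p q by (auto elim!: converse_rtranclE)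
next
  case False
  show ?thesis
  proof (rule ccontr)
    assume "p \<noteq> q"
    obtain s where s: "(w, s) \<in> (Restr R (V - B))\<^sup>*" "s \<in> V - B" "(s, p) \<in> R"
      using outer_path[OF p(1) False p(2) w] by blast
    obtain t where t: "(w, t) \<in> (Restr R (V - B))\<^sup>*" "t \<in> V - B" "(t, q) \<in> R"
      using outer_path[OF q(1) False q(2) w] by blast
    have "(s, t) \<in> (Restr R (V - B))\<^sup>*"
      using s t rtrancl_symD[OF sym_Restr[OF sym_R]] by (meson rtrancl_trans)
    then obtain xs where xs: "xs \<noteq> []" "hd xs = s" "last xs = t" "distinct xs"
      "successively (\<lambda>x y. (x, y) \<in> Restr R (V - B)) xs"
      using rtrancl_imp_distinct_path by metis
    have out: "set xs \<subseteq> V - B"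
    proof
      fix x assume "x \<in> set xs"
      from successively_rtrancl_hd[OF xs(5) this subset_UNIV]
      show "x \<in> V - B" using s xs by (auto elim: rtranclE)
    qed
    have "successively (\<lambda>x y. (x, y) \<in> R) xs"
      using xs(5) by (rule successively_mono) auto
    then have "nonseparable R (B \<union> set xs)"
      using B xs out s t p q sym_R \<open>p \<noteq> q\<close>
      by (intro nonseparable_add_ear[of R B p q xs]) (auto simp: is_max_nonsep_def)
    moreover have "B \<subseteq> V" "\<And>T. B \<subseteq> T \<Longrightarrow> T \<subseteq> V \<Longrightarrow> nonseparable R T \<Longrightarrow> T = B"
      using B unfolding is_max_nonsep_def by blast+
    ultimately have "B \<union> set xs = B"
      using out by blast
    then show False using out xs by (cases xs) auto
  qed
qed

lemma gate_ex: "w \<in> V \<Longrightarrow> \<exists>p. p \<in> B \<and> (w, p) \<in> R'\<^sup>*"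
proof -
  assume w: "w \<in> V"
  obtain b where b: "b \<in> B" "b \<in> V" using B by (auto simp: is_max_nonsep_def)
  have "(w, b) \<in> R\<^sup>*" using reach w b by blast
  then show ?thesis
  proof (induction rule: converse_rtrancl_induct)
    case base
    then show ?case using b by blast
  next
    case (step y z)
    then show ?case
      by (cases "y \<in> B") (auto intro: converse_rtrancl_into_rtrancl)
  qed
qed

lemma gate_in: "w \<in> V \<Longrightarrow> gate B w \<in> B"
  and gate_path: "w \<in> V \<Longrightarrow> (w, gate B w) \<in> R'\<^sup>*"
  using someI_ex[OF gate_ex] unfolding gate_def by auto

lemma gate_eqI: "w \<in> V \<Longrightarrow> p \<in> B \<Longrightarrow> (w, p) \<in> R'\<^sup>* \<Longrightarrow> gate B w = p"
  using outer_path_unique gate_in gate_path by blast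

lemma gate_in_block: "w \<in> B \<Longrightarrow> gate B w = w"
  using B by (intro gate_eqI) (auto simp: is_max_nonsep_def)

text \<open>An edge starting outside \<open>B\<close> can be prepended to the walk from its other
  end to the gate. Hence the gate changes only along edges inside \<open>B\<close>.\<close>

lemma gate_step:
  assumes "(a, b) \<in> R" "a \<notin> B \<or> b \<notin> B"
  shows "gate B a = gate B b"
proof -
  have *: "gate B a = gate B b" if "(a, b) \<in> R" "a \<notin> B" for a b
    using that gate_in[of b] gate_path[of b] R_sub
    by (intro gate_eqI) (auto intro: converse_rtrancl_into_rtrancl)
  show ?thesis using assms *[of a b] *[of b a] sym_R by (auto dest: symD)
qed

text \<open>Induction along the walk: a first step that keeps the gate costs at most one by the
  triangle inequality; a step that changes it lies inside \<open>B\<close>, where every vertex is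
  its own gate.\<close>

lemma walk_through_gates:
  assumes "(w, w') \<in> R ^^ n" "w' \<in> V" "gate B w \<noteq> gate B w'"
  shows "d w (gate B w) + d (gate B w) (gate B w') + d (gate B w') w' \<le> n"
  using assms
proof (induction n arbitrary: w)
  case (Suc n)
  then obtain z where z: "(w, z) \<in> R" "(z, w') \<in> R ^^ n"
    by (meson relpow_Suc_E2)
  have V: "w \<in> V" "z \<in> V" using z R_sub by auto
  have BV: "B \<subseteq> V" using B by (auto simp: is_max_nonsep_def)
  have gV: "gate B w \<in> V" "gate B w' \<in> V" using gate_in V Suc.prems BV by auto
  have one: "d w z \<le> 1" using z(1) by (intro dist_le) auto
  show ?case
  proof (cases "gate B w = gate B z")
    case True
    then show ?thesis
      using Suc.IH[OF z(2)] Suc.prems dist_triangle[OF V gV(1)] one by auto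
  next
    case False
    then have "w \<in> B" "z \<in> B" using gate_step[OF z(1)] by auto
    then have eq: "gate B w = w" "gate B z = z" using gate_in_block by auto
    show ?thesis
    proof (cases "gate B z = gate B w'")
      case True
      then show ?thesis using eq one dist_le[OF z(2)] by auto
    next
      case F: False
      then show ?thesis
        using Suc.IH[OF z(2)] Suc.prems eq dist_triangle[OF V gV(2)] one by auto
    qed
  qed
qed auto

lemma dist_through_gates:
  assumes "w \<in> V" "w' \<in> V" "gate B w \<noteq> gate B w'"
  shows "d w w' = d w (gate B w) + d (gate B w) (gate B w') + d (gate B w') w'"
proof (rule antisym)
  have gV: "gate B w \<in> V" "gate B w' \<in> V"
    using gate_in assms B by (auto simp: is_max_nonsep_def)
  show "d w w' \<le> d w (gate B w) + d (gate B w) (gate B w') + d (gate B w') w'"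
    using dist_triangle[OF assms(1) gV(1) assms(2)] dist_triangle[OF gV assms(2)] by auto
qed (use walk_through_gates[OF dist_attained] assms in auto)

text \<open>A walk that avoids the gate of \<open>w\<close> keeps this gate and hence never enters
  \<open>B\<close>: on entering it would be at its own gate.\<close>

lemma gate_separates:
  assumes "w \<in> V - B" "b \<in> B" "b \<noteq> gate B w"
  shows "(w, b) \<notin> (Restr R (V - {gate B w}))\<^sup>*"
proof
  assume "(w, b) \<in> (Restr R (V - {gate B w}))\<^sup>*"
  then have "b \<notin> B \<and> gate B b = gate B w"
  proof (induction rule: rtrancl_induct)
    case (step y z)
    then have "gate B z = gate B y" using gate_step[of y z] by auto
    then show ?case using step gate_in_block[of z] by auto
  qed (use assms in auto)
  then show False using assms by auto
qed

end

lemma max_nonsep_containing: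
  assumes "nonseparable R S" "S \<subseteq> V" "S \<noteq> {}"
  shows "\<exists>B. is_max_nonsep B \<and> S \<subseteq> B"
proof -
  let ?F = "{T. S \<subseteq> T \<and> T \<subseteq> V \<and> nonseparable R T}"
  have "finite ?F" using finite_V by (intro finite_subset[of ?F "Pow V"]) auto
  moreover have "S \<in> ?F" using assms by auto
  ultimately have "\<exists>B\<in>?F. S \<subseteq> B \<and> (\<forall>T\<in>?F. B \<subseteq> T \<longrightarrow> B = T)"
    by (rule finite_has_maximal2)
  then obtain B where B: "B \<in> ?F" "S \<subseteq> B" "\<forall>T\<in>?F. B \<subseteq> T \<longrightarrow> B = T" by blast
  have "T = B" if "B \<subseteq> T" "T \<subseteq> V" "nonseparable R T" for T
    using B(3)[rule_format, of T] B(2) that by blast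
  moreover have "B \<noteq> {}" "B \<subseteq> V" "nonseparable R B" using B(1,2) assms(3) by blast+
  ultimately have "is_max_nonsep B" unfolding is_max_nonsep_def by blast
  then show ?thesis using B(2) by blast
qed

lemma nonseparable_edge: "(x, y) \<in> R \<Longrightarrow> nonseparable R {x, y}"
proof -
  assume xy: "(x, y) \<in> R"
  have "(y, x) \<in> R" using xy sym_R by (auto dest: symD)
  have "connected_on R ({x, y} - {v})" if "v \<in> {x, y}" for v
    using that by (auto simp: connected_on_def)
  moreover have "connected_on R {x, y}"
    using xy \<open>(y, x) \<in> R\<close> by (auto simp: connected_on_def intro!: r_into_rtrancl)
  ultimately show ?thesis
    unfolding nonseparable_def by (metis Diff_empty Diff_insert0)
qed

end

section \<open>Eccentricities in gated metrics\<close>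

text \<open>Metric shadow of a block: \<open>\<sigma>\<close> is the side in the bipartition and
  \<open>g\<close> the gate map. The gates of outside vertices will be cut-vertices in the block,
  whence the bound 2.\<close>

definition gated_block ::
  "'a set \<Rightarrow> ('a \<Rightarrow> 'a \<Rightarrow> nat) \<Rightarrow> 'a set \<Rightarrow> ('a \<Rightarrow> bool) \<Rightarrow> ('a \<Rightarrow> 'a) \<Rightarrow> bool" where
  "gated_block V d B \<sigma> g \<longleftrightarrow> B \<subseteq> V \<and>
     (\<forall>a\<in>B. \<forall>b\<in>B. d a b = (if a = b then 0 else if \<sigma> a = \<sigma> b then 2 else 1)) \<and>
     (\<forall>w\<in>V. g w \<in> B) \<and> (\<forall>b\<in>B. g b = b) \<and>
     (\<forall>w\<in>V. \<forall>w'\<in>V. g w \<noteq> g w' \<longrightarrow> d w w' = d w (g w) + d (g w) (g w') + d (g w') w') \<and>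
     card (g ` (V - B)) \<le> 2"

lemma gated_blockD:
  assumes "gated_block V d B \<sigma> g"
  shows "B \<subseteq> V"
    and "a \<in> B \<Longrightarrow> b \<in> B \<Longrightarrow> d a b = (if a = b then 0 else if \<sigma> a = \<sigma> b then 2 else 1)"
    and "w \<in> V \<Longrightarrow> g w \<in> B" and "b \<in> B \<Longrightarrow> g b = b"
    and "w \<in> V \<Longrightarrow> w' \<in> V \<Longrightarrow> g w \<noteq> g w' \<Longrightarrow> d w w' = d w (g w) + d (g w) (g w') + d (g w') w'"
    and "card (g ` (V - B)) \<le> 2"
  using assms unfolding gated_block_def by blast+

text \<open>Collects the facts about the graph distance on which the eccentricity estimates rest;
  pairs at distance 1 are the edges.\<close>

locale gated_metric =
  fixes V :: "'a set" and d :: "'a \<Rightarrow> 'a \<Rightarrow> nat"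
  assumes finite_V: "finite V" and nonempty_V: "V \<noteq> {}"
    and d_commute: "u \<in> V \<Longrightarrow> v \<in> V \<Longrightarrow> d u v = d v u"
    and d_eq_0: "u \<in> V \<Longrightarrow> v \<in> V \<Longrightarrow> d u v = 0 \<longleftrightarrow> u = v"
    and d_triangle: "u \<in> V \<Longrightarrow> v \<in> V \<Longrightarrow> w \<in> V \<Longrightarrow> d u w \<le> d u v + d v w"
    and d_split: "u \<in> V \<Longrightarrow> v \<in> V \<Longrightarrow> k \<le> d u v \<Longrightarrow> \<exists>x\<in>V. d u x = k \<and> d x v = d u v - k"
    and gates: "x \<in> V \<Longrightarrow> y \<in> V \<Longrightarrow> d x y = 1 \<Longrightarrow>
      \<exists>B \<sigma> g. x \<in> B \<and> y \<in> B \<and> gated_block V d B \<sigma> g"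
begin

section \<open>Eccentricity, diameter and the middle of a diametral path\<close>

definition ecc :: "'a \<Rightarrow> nat" where "ecc u = Max (d u ` V)"
definition dia :: nat where "dia = Max (ecc ` V)"

lemma d_le_ecc: "v \<in> V \<Longrightarrow> d u v \<le> ecc u"
  unfolding ecc_def using finite_V by (intro Max_ge) auto

lemma ecc_le_dia: "u \<in> V \<Longrightarrow> ecc u \<le> dia"
  unfolding dia_def using finite_V by (intro Max_ge) auto

lemma d_le_dia: "u \<in> V \<Longrightarrow> v \<in> V \<Longrightarrow> d u v \<le> dia"
  using d_le_ecc ecc_le_dia le_trans by blast

lemma dia_attained: obtains u v where "u \<in> V" "v \<in> V" "d u v = dia"
proof -
  have "dia \<in> ecc ` V" unfolding dia_def using finite_V nonempty_V by (intro Max_in) auto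
  then obtain u where u: "u \<in> V" "ecc u = dia" by auto
  have "ecc u \<in> d u ` V" unfolding ecc_def using finite_V nonempty_V by (intro Max_in) auto
  then show thesis using u that by auto
qed

lemma ecc_leI: "(\<And>v. v \<in> V \<Longrightarrow> d u v \<le> k) \<Longrightarrow> ecc u \<le> k"
  unfolding ecc_def using finite_V nonempty_V by (subst Max_le_iff) auto

text \<open>Let \<open>a\<close>, \<open>x\<close>, \<open>b\<close> be the middle vertices of the diametral path and \<open>B\<close> the block of the edge
  \<open>a x\<close>. If \<open>b\<close> is outside \<open>B\<close>, then \<open>x\<close> separates \<open>u\<close> from \<open>v\<close>; otherwise \<open>a\<close> and \<open>b\<close> are the only
  two gates of \<open>B\<close>. In both cases a vertex too far from \<open>x\<close> is too far from \<open>u\<close> or \<open>v\<close>.\<close>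

lemma central_vertex:
  assumes dia: "dia = 2 * r" "r \<ge> 2"
    and u: "u \<in> V" and v: "v \<in> V" and x: "x \<in> V"
    and dux: "d u x = r" and dxv: "d x v = r" and duv: "d u v = 2 * r"
  shows "ecc x \<le> r"
proof -
  obtain a where a: "a \<in> V" "d u a = r - 1" "d a x = 1"
    using d_split[OF u x, of "r - 1"] dux dia(2) by auto
  obtain b where b: "b \<in> V" "d x b = 1" "d b v = r - 1"
    using d_split[OF x v, of 1] dxv dia(2) by auto
  obtain B \<sigma> g where B0: "a \<in> B" "x \<in> B" and gb: "gated_block V d B \<sigma> g"
    using gates[OF a(1) x a(3)] by blast
  note B = B0 gated_blockD(1)[OF gb]
  note dB = gated_blockD(2)[OF gb] and gB = gated_blockD(3)[OF gb] and gid = gated_blockD(4)[OF gb]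
    and thru = gated_blockD(5)[OF gb] and card = gated_blockD(6)[OF gb]
  have self: "d z z = 0" if "z \<in> V" for z using d_eq_0 that by blast
  have gV: "g w \<in> V" if "w \<in> V" for w using gB B that by blast
  have to_B: "d w z = d w (g w) + d (g w) z" if "w \<in> V" "z \<in> B" for w z
    using thru[of w z] that gid[of z] self[of z] B by (cases "g w = z") auto
  have le2: "d y z \<le> 2" if "y \<in> B" "z \<in> B" for y z using dB[OF that] by auto
  have dav: "d a v = r + 1"
    using d_triangle[OF u a(1) v] d_triangle[OF a(1) x v] a dxv duv dia by linarith
  have dub: "d u b = r + 1"
    using d_triangle[OF u b(1) v] d_triangle[OF u x b(1)] b dux duv dia by linarith
  have dab: "d a b = 2"
    using d_triangle[OF u a(1) b(1)] d_triangle[OF a(1) x b(1)] a b dub dia by linarith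
  have "d w x \<le> r" if w: "w \<in> V" for w
  proof (cases "b \<in> B")
    case False
    \<comment> \<open>Outside \<open>B\<close>, the vertex \<open>b\<close> is at distance at least
      1 from its gate. As \<open>d x b = 1\<close>, nothing is left for the way from the gate to
      \<open>x\<close>.\<close>
    have gb: "g b = x"
    proof -
      have "d b (g b) \<noteq> 0" using d_eq_0[OF b(1) gV[OF b(1)]] gB[OF b(1)] False by auto
      then have "d (g b) x = 0" using to_B[OF b(1) B(2)] d_commute[OF b(1) x] b by linarith
      then show ?thesis using d_eq_0 gV b x by blast
    qed
    \<comment> \<open>Otherwise a shortest path from \<open>v\<close> to \<open>b\<close> would run
      through \<open>x\<close>, although \<open>b\<close> is nearer to \<open>v\<close> than
      \<open>x\<close> is.\<close>
    have gv: "g v = x"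
    proof (rule ccontr)
      assume "g v \<noteq> x"
      then have "d v b = d v (g v) + d (g v) x + d x b" using thru[OF v b(1)] gb by auto
      then have "d v b = d v x + 1" using to_B[OF v B(2)] b by simp
      then show False using d_commute[OF v b(1)] d_commute[OF v x] dxv b dia by simp
    qed
    have gu: "g u \<noteq> x"
    proof
      assume "g u = x"
      then have "d u a = d u x + d x a" using to_B[OF u B(1)] by simp
      then show False using a dux dia by simp
    qed
    show ?thesis
    proof (cases "g w = x")
      case True
      then have "d w u = d w x + d x (g u) + d (g u) u" using thru[OF w u] gu by auto
      moreover have "d u x = d u (g u) + d (g u) x" using to_B[OF u B(2)] .
      ultimately have "d w u = d w x + r"
        using d_commute[OF x gV[OF u]] d_commute[OF gV[OF u] u] dux by linarith
      then show ?thesis using d_le_dia[OF w u] dia by linarith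
    next
      case False
      then have "d w v = d w (g w) + d (g w) x + d x v" using thru[OF w v] gv by auto
      then show ?thesis using to_B[OF w B(2)] d_le_dia[OF w v] dia dxv by linarith
    qed
  next
    case True
    \<comment> \<open>From \<open>u\<close>, the vertex \<open>b\<close> is 2 farther than
      \<open>a\<close>. Distances in \<open>B\<close> are at most 2, so \<open>g u\<close> has
      distance 0 to \<open>a\<close>.\<close>
    have gu: "g u = a"
    proof -
      have "d (g u) b = d (g u) a + 2"
        using to_B[OF u B(1)] to_B[OF u True] a dub dia by linarith
      then have "d (g u) a = 0" using le2[OF gB[OF u] True] by linarith
      then show ?thesis using d_eq_0 gV u a by blast
    qed
    have gv: "g v = b"
    proof -
      have "d (g v) a = d (g v) b + 2"
        using to_B[OF v B(1)] to_B[OF v True] b dav d_commute[OF v a(1)] d_commute[OF v b(1)] dia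
        by linarith
      then have "d (g v) b = 0" using le2[OF gB[OF v] B(1)] by linarith
      then show ?thesis using d_eq_0 gV v b by blast
    qed
    have "u \<notin> B" using le2[of u b] True dub dia by auto
    moreover have "v \<notin> B" using le2[of a v] B dav dia by auto
    \<comment> \<open>Since \<open>u\<close> and \<open>v\<close> lie outside \<open>B\<close>,
      their gates \<open>a\<close> and \<open>b\<close> exhaust the two that are allowed.\<close>
    ultimately have "{a, b} \<subseteq> g ` (V - B)" using u v gu gv by blast
    moreover have "card {a, b} = 2" using dab self[OF a(1)] by (cases "a = b") auto
    moreover have "finite (g ` (V - B))" using finite_V by blast
    ultimately have im: "g ` (V - B) = {a, b}" using card by (metis card_seteq)
    have ab: "a \<noteq> b" using dab self[OF a(1)] by auto
    show ?thesis
    proof (cases "w \<in> B")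
      case True
      then show ?thesis using le2[of w x] B dia by simp
    next
      case False
      then consider "g w = a" | "g w = b" using im w by blast
      then show ?thesis
      proof cases
        case 1
        then have "d w v = d w a + d a b + d b v" using thru[OF w v] gv ab by auto
        then have "d w a \<le> r - 1" using dab b d_le_dia[OF w v] dia by linarith
        then show ?thesis using d_triangle[OF w a(1) x] a dia by linarith
      next
        case 2
        then have "d w u = d w b + d b a + d a u" using thru[OF w u] gu ab by auto
        then have "d w b \<le> r - 1"
          using dab a d_le_dia[OF w u] dia d_commute[OF a(1) b(1)] d_commute[OF a(1) u] by linarith
        then show ?thesis using d_triangle[OF w b(1) x] b d_commute[OF x b(1)] dia by linarith
      qed
    qed
  qed
  then show ?thesis using d_commute[OF x] by (intro ecc_leI) auto
qed

text \<open>Take the ends \<open>u\<close>, \<open>v\<close> of a diametral path, of eccentricity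
  \<open>dia\<close>, and its middle vertex \<open>x\<close>, of eccentricity \<open>dia / 2\<close>
  by \<open>central_vertex\<close>.\<close>

lemma even_dia_triangle:
  assumes "even dia" "dia \<ge> 4"
  obtains u v x where "u \<in> V" "v \<in> V" "x \<in> V"
    "d u v = min (ecc u) (ecc v)" "d v x = min (ecc v) (ecc x)" "d u x = min (ecc u) (ecc x)"
    "d u v > 0" "d v x > 0" "d u x > 0"
proof -
  obtain r where r: "dia = 2 * r" using assms by blast
  then have r2: "r \<ge> 2" using assms by simp
  obtain u v where uv: "u \<in> V" "v \<in> V" "d u v = dia" by (rule dia_attained)
  obtain x where x: "x \<in> V" "d u x = r" "d x v = r"
    using d_split[OF uv(1,2), of r] uv r by auto
  have "ecc x \<le> r" using central_vertex[OF r r2 uv(1,2) x] uv r by simp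
  then have ex: "ecc x = r" using d_le_ecc[OF uv(2), of x] x by simp
  have "ecc u = dia" "ecc v = dia"
    using d_le_ecc[OF uv(2), of u] d_le_ecc[OF uv(1), of v] uv d_commute[OF uv(1,2)]
      ecc_le_dia[OF uv(1)] ecc_le_dia[OF uv(2)] by simp_all
  then show thesis
    using that[OF uv(1,2) x(1)] ex uv x r r2 d_commute[OF x(1) uv(2)] by simp
qed

text \<open>Each vertex lies behind the first gate, behind the second, or is another vertex of
  \<open>B\<close>. Two vertices of one group are nearer to each other than either eccentricity, and
  the third group can be distributed over two sides without losing this. The diameter is
  \<open>2 * r - 1\<close> in both cases of the last assumption.\<close>

lemma odd_dia_bipartition_aux:
  assumes u: "u \<in> V" and v: "v \<in> V" and gb: "gated_block V d B \<sigma> g"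
    and gates: "g ` (V - B) \<subseteq> {g u, g v}"
    and dia: "d u (g u) + d (g u) (g v) + d (g v) v = dia"
    and r: "r \<ge> 3" "d u (g u) = r - 1"
    and cases: "d (g u) (g v) = 1 \<and> d (g v) v = r - 1 \<or> d (g u) (g v) = 2 \<and> d (g v) v = r - 2"
  shows "\<exists>S. \<forall>w\<in>V. \<forall>w'\<in>V. d w w' = min (ecc w) (ecc w') \<longrightarrow> (w \<in> S) \<noteq> (w' \<in> S)"
proof -
  note B = gated_blockD(1)[OF gb] and dB = gated_blockD(2)[OF gb] and gB = gated_blockD(3)[OF gb]
    and gid = gated_blockD(4)[OF gb] and thru = gated_blockD(5)[OF gb]
  \<comment> \<open>The diametral path is a branch of length \<open>\<alpha>\<close> ending at
    \<open>c1\<close>, a stretch \<open>\<delta>\<close> inside the block, and a branch of length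
    \<open>\<beta>\<close> from \<open>c2\<close>.\<close>
  define c1 c2 \<alpha> \<beta> \<delta>
    where defs: "c1 = g u" "c2 = g v" "\<alpha> = d u (g u)" "\<beta> = d (g v) v" "\<delta> = d (g u) (g v)"
  have self: "d z z = 0" if "z \<in> V" for z using d_eq_0 that by blast
  have gV: "g w \<in> V" if "w \<in> V" for w using gB B that by blast
  have to_B: "d w z = d w (g w) + d (g w) z" if "w \<in> V" "z \<in> B" for w z
    using thru[of w z] that gid[of z] self[of z] B by (cases "g w = z") auto
  have cB: "c1 \<in> B" "c2 \<in> B" and cV: "c1 \<in> V" "c2 \<in> V" using gB gV u v by (auto simp: defs)
  have c12: "c1 \<noteq> c2" using cases self[OF cV(1)] by (auto simp: defs)
  have sym: "d c2 c1 = \<delta>" "d c1 u = \<alpha>"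
    using d_commute cV u by (simp_all add: defs)
  \<comment> \<open>Measured against \<open>v\<close>, which is reached from \<open>w\<close>
    through both gates; \<open>Rr\<close> is the mirror image with \<open>u\<close>.\<close>
  have L: "d w c1 \<le> \<alpha>" "ecc w \<ge> d w c1 + \<delta> + \<beta>" if "w \<in> V" "g w = c1" for w
  proof -
    have "d w v = d w c1 + \<delta> + \<beta>"
      using thru[OF that(1) v] that(2) c12 by (simp add: defs)
    then show "d w c1 \<le> \<alpha>" "ecc w \<ge> d w c1 + \<delta> + \<beta>"
      using d_le_dia[OF that(1) v] d_le_ecc[OF v, of w] dia by (simp_all add: defs)
  qed
  have Rr: "d w c2 \<le> \<beta>" "ecc w \<ge> d w c2 + \<delta> + \<alpha>" if "w \<in> V" "g w = c2" for w
  proof -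
    have "d w u = d w c2 + \<delta> + \<alpha>"
      using thru[OF that(1) u] that(2) c12 sym by (simp add: defs)
    then show "d w c2 \<le> \<beta>" "ecc w \<ge> d w c2 + \<delta> + \<alpha>"
      using d_le_dia[OF that(1) u] d_le_ecc[OF u, of w] dia by (simp_all add: defs)
  qed
  \<comment> \<open>A vertex of the block is measured against both ends \<open>u\<close> and
    \<open>v\<close>.\<close>
  have M: "ecc w \<ge> d w c1 + \<alpha>" "ecc w \<ge> d w c2 + \<beta>" if "w \<in> B" for w
  proof -
    have wV: "w \<in> V" using that B by blast
    have "d u w = \<alpha> + d c1 w" "d v w = \<beta> + d c2 w"
      using to_B[OF u that] to_B[OF v that] d_commute[OF v gV[OF v]] by (simp_all add: defs)
    then show "ecc w \<ge> d w c1 + \<alpha>" "ecc w \<ge> d w c2 + \<beta>"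
      using d_le_ecc[OF u, of w] d_le_ecc[OF v, of w] d_commute[OF wV] u v cV by auto
  qed
  have middle: "w \<in> B \<and> w \<noteq> c1 \<and> w \<noteq> c2" if "w \<in> V" "g w \<noteq> c1" "g w \<noteq> c2" for w
  proof -
    have "w \<in> B" using gates that by (auto simp: defs)
    then show ?thesis using gid that by auto
  qed
  \<comment> \<open>Two vertices behind \<open>c1\<close> are within
    \<open>d w c1 + \<alpha>\<close>, and \<open>\<alpha> < \<delta> + \<beta>\<close>. Likewise
    \<open>RR\<close> rests on \<open>\<beta> < \<delta> + \<alpha>\<close>.\<close>
  have LL: "d w w' < ecc w" if "w \<in> V" "w' \<in> V" "g w = c1" "g w' = c1" for w w'
    using d_triangle[OF that(1) cV(1) that(2)] L[OF that(1,3)] L[OF that(2,4)]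
      d_commute[OF that(2) cV(1)] cases r by (auto simp: defs)
  have RR: "d w w' < ecc w" if "w \<in> V" "w' \<in> V" "g w = c2" "g w' = c2" for w w'
    using d_triangle[OF that(1) cV(2) that(2)] Rr[OF that(1,3)] Rr[OF that(2,4)]
      d_commute[OF that(2) cV(2)] cases r by (auto simp: defs)
  \<comment> \<open>Block distances are at most 2, whereas the eccentricity is at least
    \<open>1 + \<alpha> = r\<close>; this is where \<open>r \<ge> 3\<close> enters.\<close>
  have MM: "d w w' < ecc w" if "w \<in> V" "w' \<in> V" "g w \<noteq> c1" "g w \<noteq> c2" "g w' \<noteq> c1" "g w' \<noteq> c2" for w w'
  proof -
    have w: "w \<in> B" "w \<noteq> c1" "w' \<in> B" using middle that by auto
    have "d w w' \<le> 2" using dB[OF w(1,3)] by simp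
    moreover have "d w c1 \<ge> 1" using dB[OF w(1) cB(1)] w by simp
    ultimately show ?thesis using M(1)[OF w(1)] r by (simp add: defs)
  qed
  have dM: "d m w = d m c1 + d w c1" if "m \<in> V" "g m \<noteq> c1" "g m \<noteq> c2" "w \<in> V" "g w = c1" for m w
    using to_B[OF that(4), of m] middle[OF that(1)] that d_commute cV by auto
  have dM': "d m w = d m c2 + d w c2" if "m \<in> V" "g m \<noteq> c1" "g m \<noteq> c2" "w \<in> V" "g w = c2" for m w
    using to_B[OF that(4), of m] middle[OF that(1)] that d_commute cV by auto
  show ?thesis
  proof (cases "\<delta> = 1")
    case True
    then have ab: "\<alpha> = r - 1" "\<beta> = r - 1" using cases r by (auto simp: defs)
    have c: "d c1 c2 = 1" using True by (simp add: defs)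
    have \<sigma>: "\<sigma> c1 \<noteq> \<sigma> c2" using dB[OF cB] c by (metis one_neq_zero numeral_eq_one_iff semiring_norm(85))
    have \<sigma>m: "d m c1 = (if \<sigma> m = \<sigma> c1 then 2 else 1)" "d m c2 = (if \<sigma> m = \<sigma> c2 then 2 else 1)"
      if "m \<in> B" "m \<noteq> c1" "m \<noteq> c2" for m
      using dB[OF that(1) cB(1)] dB[OF that(1) cB(2)] that(2,3) by presburger+
    \<comment> \<open>Adjacent gates lie on opposite sides, so a neighbour \<open>m\<close> of
      \<open>c1\<close> is at distance 2 from \<open>c2\<close>. Its eccentricity is then at least
      \<open>r + 1\<close>, while \<open>d m w \<le> r\<close>.\<close>
    have M1: "d m w < ecc m" "d m w < ecc w"
      if "m \<in> V" "g m \<noteq> c1" "g m \<noteq> c2" "d m c1 = 1" "w \<in> V" "g w = c1" for m w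
    proof -
      have m: "m \<in> B" "m \<noteq> c1" "m \<noteq> c2" using middle that by auto
      have "d m c2 = 2" using \<sigma>m[OF m] \<sigma> that(4) by (auto split: if_splits)
      then show "d m w < ecc m" "d m w < ecc w"
        using dM[OF that(1,2,3,5,6)] M(2)[OF m(1)] L[OF that(5,6)] ab True r that(4) by auto
    qed
    have M2: "d m w < ecc m" "d m w < ecc w"
      if "m \<in> V" "g m \<noteq> c1" "g m \<noteq> c2" "d m c1 \<noteq> 1" "w \<in> V" "g w = c2" for m w
    proof -
      have m: "m \<in> B" "m \<noteq> c1" "m \<noteq> c2" using middle that by auto
      have "d m c2 = 1" "d m c1 = 2"
        using \<sigma>m[OF m] \<sigma> that(4) by (auto split: if_splits)
      then show "d m w < ecc m" "d m w < ecc w"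
        using dM'[OF that(1,2,3,5,6)] M(1)[OF m(1)] Rr[OF that(5,6)] ab True r by auto
    qed
    \<comment> \<open>Non-gate vertices of the block join the side of their neighbour among \<open>c1\<close>, \<open>c2\<close>.\<close>
    define S where "S = {w. g w = c1 \<or> g w \<noteq> c2 \<and> d w c1 = 1}"
    have one: "d w w' < ecc w"
      if w: "w \<in> V" "w' \<in> V" "(w \<in> S) = (w' \<in> S)" for w w'
    proof -
      note com = d_commute[OF w(2,1)]
      consider "w \<in> S" "w' \<in> S" | "w \<notin> S" "w' \<notin> S" using w(3) by blast
      then show ?thesis
      proof cases
        case 1
        then show ?thesis
          using w LL[of w w'] MM[of w w'] M1[of w w'] M1[of w' w, unfolded com]
          unfolding S_def mem_Collect_eq by blast
      next
        case 2
        then show ?thesis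
          using w RR[of w w'] MM[of w w'] M2[of w w'] M2[of w' w, unfolded com]
          unfolding S_def mem_Collect_eq by blast
      qed
    qed
    have "d w w' < min (ecc w) (ecc w')" if "w \<in> V" "w' \<in> V" "(w \<in> S) = (w' \<in> S)" for w w'
      using one[OF that] one[OF that(2,1) that(3)[symmetric]] d_commute[OF that(1,2)] by simp
    then show ?thesis by (intro exI[of _ S]) (metis nat_less_le)
  next
    case False
    then have ab: "\<alpha> = r - 1" "\<beta> = r - 2" "\<delta> = 2" using cases r by (auto simp: defs)
    have "d c1 c2 = 2" using ab by (simp add: defs)
    then have \<sigma>: "\<sigma> c1 = \<sigma> c2" using dB[OF cB] by (auto split: if_splits)
    \<comment> \<open>The gates now lie on one side, so \<open>m\<close> is equally far from both.
      The branch at \<open>c1\<close> is longer by one, so \<open>u\<close> is farther from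
      \<open>m\<close> than anything behind \<open>c2\<close>.\<close>
    have M1: "d m w < ecc m" "d m w < ecc w"
      if "m \<in> V" "g m \<noteq> c1" "g m \<noteq> c2" "w \<in> V" "g w = c2" for m w
    proof -
      have m: "m \<in> B" "m \<noteq> c1" "m \<noteq> c2" using middle that by auto
      have "d m c2 = d m c1" "d m c1 \<le> 2"
        using dB[OF m(1) cB(1)] dB[OF m(1) cB(2)] m \<sigma> by auto
      then show "d m w < ecc m" "d m w < ecc w"
        using dM'[OF that] M(1)[OF m(1)] Rr[OF that(4,5)] ab r by auto
    qed
    \<comment> \<open>Here \<open>c1\<close> carries the longer half, and only the vertices behind \<open>c1\<close> form one side.\<close>
    define S where "S = {w. g w = c1}"
    have one: "d w w' < ecc w"
      if w: "w \<in> V" "w' \<in> V" "(w \<in> S) = (w' \<in> S)" for w w'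
    proof -
      note com = d_commute[OF w(2,1)]
      consider "w \<in> S" "w' \<in> S" | "w \<notin> S" "w' \<notin> S" using w(3) by blast
      then show ?thesis
      proof cases
        case 1
        then show ?thesis
          using w LL[of w w'] by (auto simp: S_def)
      next
        case 2
        then show ?thesis
          using w RR[of w w'] MM[of w w'] M1[of w w'] M1[of w' w, unfolded com]
          unfolding S_def mem_Collect_eq by blast
      qed
    qed
    have "d w w' < min (ecc w) (ecc w')" if "w \<in> V" "w' \<in> V" "(w \<in> S) = (w' \<in> S)" for w w'
      using one[OF that] one[OF that(2,1) that(3)[symmetric]] d_commute[OF that(1,2)] by simp
    then show ?thesis by (intro exI[of _ S]) (metis nat_less_le)
  qed
qed

text \<open>Take the block of the middle edge \<open>x y\<close> of a diametral path. The gate of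
  \<open>u\<close> is \<open>x\<close> or one step before it, that of \<open>v\<close> is
  \<open>y\<close> or one step after it. Not both are off the edge, since block distances are at
  most 2.\<close>

lemma odd_dia_bipartition:
  assumes "odd dia" "dia \<ge> 4"
  shows "\<exists>S. \<forall>w\<in>V. \<forall>w'\<in>V. d w w' = min (ecc w) (ecc w') \<longrightarrow> (w \<in> S) \<noteq> (w' \<in> S)"
proof -
  have "even (dia + 1)" using assms by simp
  then obtain r where r: "dia + 1 = 2 * r" by blast
  then have r3: "r \<ge> 3" using assms by simp
  obtain u v where uv: "u \<in> V" "v \<in> V" "d u v = dia" by (rule dia_attained)
  note u = uv(1) and v = uv(2)
  obtain x where x: "x \<in> V" "d u x = r - 1" "d x v = r"
    proof -
    have "r - 1 \<le> dia" "dia - (r - 1) = r" using r by linarith+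
    then show ?thesis using d_split[OF u v, of "r - 1"] uv that by auto
  qed
  obtain y where y: "y \<in> V" "d x y = 1" "d y v = r - 1"
    using d_split[OF x(1) v, of 1] x r3 by auto
  obtain B \<sigma> g where B0: "x \<in> B" "y \<in> B" and gb: "gated_block V d B \<sigma> g"
    using gates[OF x(1) y(1,2)] by blast
  note B = B0 gated_blockD(1)[OF gb]
  note dB = gated_blockD(2)[OF gb] and gB = gated_blockD(3)[OF gb] and gid = gated_blockD(4)[OF gb]
    and thru = gated_blockD(5)[OF gb] and card = gated_blockD(6)[OF gb]
  have self: "d z z = 0" if "z \<in> V" for z using d_eq_0 that by blast
  have gV: "g w \<in> V" if "w \<in> V" for w using gB B that by blast
  have to_B: "d w z = d w (g w) + d (g w) z" if "w \<in> V" "z \<in> B" for w z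
    using thru[of w z] that gid[of z] self[of z] B by (cases "g w = z") auto
  have le2: "d y z \<le> 2" if "y \<in> B" "z \<in> B" for y z using dB[OF that] by auto
  have duy: "d u y = r"
    using d_triangle[OF u y(1) v] d_triangle[OF u x(1) y(1)] x y uv(3) r by linarith
  define c1 c2 where c: "c1 = g u" "c2 = g v"
  have cB: "c1 \<in> B" "c2 \<in> B" using gB u v by (auto simp: c)
  have cV: "c1 \<in> V" "c2 \<in> V" using cB B by auto
  have u_c1: "d u c1 + d c1 x = r - 1" "d u c1 + d c1 y = r"
    using to_B[OF u B(1)] to_B[OF u B(2)] x duy by (simp_all add: c)
  have v_c2: "d v c2 + d c2 x = r" "d v c2 + d c2 y = r - 1"
    using to_B[OF v B(1)] to_B[OF v B(2)] x y d_commute[OF v x(1)] d_commute[OF v y(1)]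
    by (simp_all add: c)
  have c1y: "d c1 y = d c1 x + 1" and c2x: "d c2 x = d c2 y + 1" using u_c1 v_c2 r3 by linarith+
  \<comment> \<open>On the way from \<open>u\<close> to \<open>y\<close> the vertex \<open>x\<close>
    comes one step earlier, so \<open>d c1 x + 1\<close> is a block distance; similarly from
    \<open>v\<close>.\<close>
  have small: "d c1 x \<le> 1" "d c2 y \<le> 1"
    using le2[OF cB(1) B(2)] le2[OF cB(2) B(1)] c1y c2x by linarith+
  have uB: "u \<notin> B"
    using le2[of u y] B duy r3 by auto
  have vB: "v \<notin> B"
    using le2[of x v] B x r3 by auto
  have c12: "c1 \<noteq> c2"
  proof
    assume "c1 = c2"
    then show False using c1y c2x by simp
  qed
  have D: "dia = d u c1 + d c1 c2 + d c2 v" using thru[OF u v] uv c12 by (simp add: c)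
  have vc2: "d c2 v = d v c2" using d_commute v cV by blast
  have \<delta>: "d c1 c2 = 1 + d c1 x + d c2 y"
    using D vc2 u_c1(1) v_c2(2) r r3 by linarith
  have "{c1, c2} \<subseteq> g ` (V - B)" using u v uB vB by (auto simp: c)
  moreover have "finite (g ` (V - B))" using finite_V by blast
  moreover have "card {c1, c2} = 2" using c12 by simp
  ultimately have im: "g ` (V - B) = {c1, c2}" using card by (metis card_seteq)
  have le: "d c1 c2 \<le> 2" using le2 cB by blast
  show ?thesis
  proof (cases "d c1 x = 0")
    case True
    show ?thesis
    proof (rule odd_dia_bipartition_aux[OF u v gb, of r])
      show "g ` (V - B) \<subseteq> {g u, g v}" using im by (simp add: c)
      show "d u (g u) + d (g u) (g v) + d (g v) v = dia" using D by (simp add: c)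
      show "d u (g u) = r - 1" using u_c1 True by (simp add: c)
      show "d (g u) (g v) = 1 \<and> d (g v) v = r - 1 \<or> d (g u) (g v) = 2 \<and> d (g v) v = r - 2"
        using True \<delta> v_c2(2) vc2 small(2) r3 by (cases "d c2 y") (auto simp: c)
    qed (use r3 in auto)
  next
    case False
    then have 1: "d c1 x = 1" "d c2 y = 0" using small \<delta> le by auto
    show ?thesis
    \<comment> \<open>The longer branch now belongs to \<open>v\<close>, so \<open>u\<close> and
      \<open>v\<close> exchange roles.\<close>
    proof (rule odd_dia_bipartition_aux[OF v u gb, of r])
      show "g ` (V - B) \<subseteq> {g v, g u}" using im by (auto simp: c)
      show "d v (g v) + d (g v) (g u) + d (g u) u = dia"
        using D vc2 d_commute[OF u cV(1)] d_commute[OF cV] by (simp add: c)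
      show "d v (g v) = r - 1" using v_c2 1 by (simp add: c)
      show "d (g v) (g u) = 1 \<and> d (g u) u = r - 1 \<or> d (g v) (g u) = 2 \<and> d (g u) u = r - 2"
        using 1 \<delta> u_c1(1) d_commute[OF u cV(1)] d_commute[OF cV] r3 by (auto simp: c)
    qed (use r3 in auto)
  qed
qed

end

section \<open>Spectra of real symmetric matrices\<close>

definition mat_trace :: "'a :: comm_ring_1 mat \<Rightarrow> 'a" where
  "mat_trace A = (\<Sum>i<dim_row A. A $$ (i, i))"

lemma mat_mult_index_sum:
  assumes "A \<in> carrier_mat n n" "B \<in> carrier_mat n n" "i < n" "j < n"
  shows "(A * B) $$ (i, j) = (\<Sum>k<n. A $$ (i, k) * B $$ (k, j))"
  using assms by (auto simp: scalar_prod_def atLeast0LessThan)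

lemma mat_trace_comm:
  assumes "A \<in> carrier_mat n n" "B \<in> carrier_mat n n"
  shows "mat_trace (A * B) = mat_trace (B * A)"
proof -
  have "mat_trace (A * B) = (\<Sum>i<n. \<Sum>k<n. A $$ (i, k) * B $$ (k, i))"
    using assms by (auto simp: mat_trace_def mat_mult_index_sum simp del: index_mult_mat(1) intro!: sum.cong)
  also have "\<dots> = (\<Sum>k<n. \<Sum>i<n. B $$ (k, i) * A $$ (i, k))"
    by (subst sum.swap) (simp add: mult.commute)
  also have "\<dots> = mat_trace (B * A)"
    using assms by (auto simp: mat_trace_def mat_mult_index_sum simp del: index_mult_mat(1) intro!: sum.cong)
  finally show ?thesis .
qed

lemma upper_triangular_mult:
  assumes A: "A \<in> carrier_mat n n" "upper_triangular A"
    and B: "B \<in> carrier_mat n n" "upper_triangular B"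
  shows "upper_triangular (A * B)"
    and "i < n \<Longrightarrow> (A * B) $$ (i, i) = A $$ (i, i) * (B $$ (i, i) :: 'a :: comm_ring_1)"
proof -
  \<comment> \<open>Only indices \<open>k\<close> between \<open>i\<close> and \<open>j\<close>
    contribute; on the diagonal this leaves \<open>k = i\<close>.\<close>
  have z: "A $$ (i, k) * B $$ (k, j) = 0" if "k < i \<or> j < k" "i < n" "j < n" "k < n" for i j k
    using that A(1) B(1) upper_triangularD[OF A(2), of k i] upper_triangularD[OF B(2), of j k] by auto
  show "upper_triangular (A * B)"
  proof
    fix i j assume ij: "j < i" "i < dim_row (A * B)"
    then have "(A * B) $$ (i, j) = (\<Sum>k<n. A $$ (i, k) * B $$ (k, j))"
      using A B by (intro mat_mult_index_sum) auto
    also have "\<dots> = 0" using z[of _ i j] ij A(1) by (intro sum.neutral ballI) force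
    finally show "(A * B) $$ (i, j) = 0" .
  qed
  assume i: "i < n"
  then have "(A * B) $$ (i, i) = (\<Sum>k<n. A $$ (i, k) * B $$ (k, i))"
    using A B by (intro mat_mult_index_sum) auto
  also have "\<dots> = (\<Sum>k<n. if k = i then A $$ (i, i) * B $$ (i, i) else 0)"
    using z i by (intro sum.cong) (auto simp: nat_neq_iff)
  also have "\<dots> = A $$ (i, i) * B $$ (i, i)" using i by simp
  finally show "(A * B) $$ (i, i) = A $$ (i, i) * B $$ (i, i)" .
qed

text \<open>For an eigenvector \<open>v\<close>, the Hermitian form \<open>T\<close> of the matrix
  at \<open>v\<close> equals \<open>a * S\<close>, where \<open>S\<close> is the squared norm. Both
  are real and \<open>S\<close> is nonzero.\<close>

lemma real_symmetric_eigenvalue_real: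
  fixes A :: "real mat"
  assumes A: "A \<in> carrier_mat n n"
    and sym: "\<And>i j. i < n \<Longrightarrow> j < n \<Longrightarrow> A $$ (i, j) = A $$ (j, i)"
    and ev: "eigenvalue (map_mat complex_of_real A) a"
  shows "a \<in> \<real>"
proof -
  let ?A = "map_mat complex_of_real A"
  have dim: "dim_row ?A = n" using A by auto
  obtain v where v: "v \<in> carrier_vec n" "v \<noteq> 0\<^sub>v n" "?A *\<^sub>v v = a \<cdot>\<^sub>v v"
    using ev unfolding eigenvalue_def eigenvector_def dim by blast
  have row: "(\<Sum>j<n. of_real (A $$ (i, j)) * v $ j) = a * v $ i" if "i < n" for i
  proof -
    have "(?A *\<^sub>v v) $ i = (\<Sum>j<n. of_real (A $$ (i, j)) * v $ j)"
      using that A v(1) by (auto simp: scalar_prod_def atLeast0LessThan)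
    moreover have "(?A *\<^sub>v v) $ i = a * v $ i" unfolding v(3) using v(1) that by simp
    ultimately show ?thesis by simp
  qed
  define S where "S = (\<Sum>i<n. cnj (v $ i) * v $ i)"
  define T where "T = (\<Sum>i<n. \<Sum>j<n. cnj (v $ i) * of_real (A $$ (i, j)) * v $ j)"
  have T: "T = a * S"
  proof -
    have "T = (\<Sum>i<n. cnj (v $ i) * (\<Sum>j<n. of_real (A $$ (i, j)) * v $ j))"
      by (simp add: T_def sum_distrib_left mult.assoc)
    also have "\<dots> = (\<Sum>i<n. cnj (v $ i) * (a * v $ i))"
      using row by (intro sum.cong) auto
    also have "\<dots> = a * S" by (simp add: S_def sum_distrib_left mult_ac)
    finally show ?thesis .
  qed
  have cS: "cnj S = S" by (simp add: S_def mult.commute)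
  have "cnj T = (\<Sum>i<n. \<Sum>j<n. cnj (v $ j) * of_real (A $$ (j, i)) * v $ i)"
    unfolding T_def by (auto simp: mult_ac sym intro!: sum.cong)
  also have "\<dots> = T" unfolding T_def by (rule sum.swap)
  finally have "cnj a * S = a * S" using T cS by simp
  moreover have "S \<noteq> 0"
  proof -
    obtain i where i: "i < n" "v $ i \<noteq> 0" using v by (metis eq_vecI carrier_vecD index_zero_vec)
    have "S = of_real (\<Sum>i<n. (cmod (v $ i))\<^sup>2)"
      by (simp add: S_def mult.commute[of "cnj _"] complex_norm_square[symmetric] del: of_real_power)
    moreover have "(\<Sum>i<n. (cmod (v $ i))\<^sup>2) > 0"
      using i by (intro sum_pos2[of _ i]) auto
    ultimately show ?thesis by (metis less_irrefl of_real_eq_0_iff)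
  qed
  ultimately show ?thesis by (metis Reals_cnj_iff mult_right_cancel)
qed

text \<open>Over the complex numbers the polynomial splits with real roots; the embedding of real
  polynomials is injective, so the factorization descends.\<close>

lemma real_symmetric_char_poly_splits:
  fixes A :: "real mat"
  assumes A: "A \<in> carrier_mat n n"
    and sym: "\<And>i j. i < n \<Longrightarrow> j < n \<Longrightarrow> A $$ (i, j) = A $$ (j, i)"
  shows "\<exists>es. char_poly A = (\<Prod>e\<leftarrow>es. [:- e, 1:])"
proof -
  interpret c: map_poly_inj_comm_ring_hom complex_of_real ..
  let ?A = "map_mat complex_of_real A"
  have cA: "?A \<in> carrier_mat n n" using A by auto
  obtain as where as: "char_poly ?A = (\<Prod>a\<leftarrow>as. [:- a, 1:])"
    using char_poly_factorized[OF cA] by blast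
  have "a \<in> \<real>" if "a \<in> set as" for a
  proof (rule real_symmetric_eigenvalue_real[OF A sym])
    show "eigenvalue ?A a"
      unfolding eigenvalue_root_char_poly[OF cA] as
      using that by (auto simp: poly_prod_list prod_list_zero_iff)
  qed
  then have "(\<Prod>a\<leftarrow>as. [:- a, 1:]) = (\<Prod>a\<leftarrow>as. map_poly complex_of_real [:- Re a, 1:])"
    by (intro arg_cong[of _ _ prod_list] map_cong) (auto simp: of_real_Re)
  also have "\<dots> = map_poly complex_of_real (\<Prod>a\<leftarrow>as. [:- Re a, 1:])"
    by (induction as) (simp_all add: hom_distribs)
  finally have "map_poly complex_of_real (char_poly A) = map_poly complex_of_real (\<Prod>a\<leftarrow>as. [:- Re a, 1:])"
    using as of_real_hom.char_poly_hom[OF A] by metis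
  then have "char_poly A = (\<Prod>e\<leftarrow>map Re as. [:- e, 1:])"
    by (simp add: o_def)
  then show ?thesis by blast
qed

lemma order_prod_linear_factors:
  "Polynomial.order x (\<Prod>e\<leftarrow>es. [:- e, 1:]) = count (mset es) (x :: 'a :: idom)"
proof (induction es)
  case (Cons e es)
  have "Polynomial.order x [:- e, 1:] = (if x = e then 1 else 0)"
    using order_power_n_n[of e 1] by (auto intro!: order_0I)
  moreover have "(\<Prod>e\<leftarrow>es. [:- e, 1:]) \<noteq> 0" by (auto simp: prod_list_zero_iff)
  then have "[:- e, 1:] * (\<Prod>e\<leftarrow>es. [:- e, 1:]) \<noteq> 0" by (metis mult_eq_0_iff pCons_eq_0_iff one_neq_zero)
  ultimately show ?case using Cons by (simp add: order_mult del: mult_pCons_left)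
qed simp

text \<open>Replaces the comparison of root orders by invariance of the multiset of roots under
  negation.\<close>

lemma eigenvalues_symmetric_iff:
  assumes "char_poly A = (\<Prod>e\<leftarrow>es. [:- e, 1:])"
  shows "eigenvalues_symmetric A \<longleftrightarrow> mset (map uminus es) = mset es"
proof -
  have "count (mset (map uminus es)) x = count (mset es) (- x)" for x
    by (induction es) auto
  then show ?thesis
    unfolding eigenvalues_symmetric_def assms order_prod_linear_factors multiset_eq_iff
    by auto
qed

text \<open>Schur triangularization with diagonal \<open>es\<close>: negating the triangular form
  negates the diagonal.\<close>

lemma char_poly_uminus:
  fixes A :: "'a :: conjugatable_ordered_field mat"
  assumes A: "A \<in> carrier_mat n n" and es: "char_poly A = (\<Prod>e\<leftarrow>es. [:- e, 1:])"
  shows "char_poly (- A) = (\<Prod>e\<leftarrow>map uminus es. [:- e, 1:])"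
proof -
  obtain B P Q where d: "schur_decomposition A es = (B, P, Q)" by (metis prod_cases3)
  note s = schur_decomposition[OF A es d]
  note w = similar_mat_witD2[OF A conjunct1[OF s]]
  have "- A = P * (- B) * Q" using w by simp
  then have "similar_mat (- A) (- B)" using w by (intro similar_matI[of _ _ P Q n]) auto
  then have "char_poly (- A) = char_poly (- B)" by (rule char_poly_similar)
  also have "\<dots> = (\<Prod>e\<leftarrow>diag_mat (- B). [:- e, 1:])"
    using s w by (intro char_poly_upper_triangular[of _ n]) (auto intro!: upper_triangularI dest: upper_triangularD)
  also have "diag_mat (- B) = map uminus es"
  proof -
    have "es = diag_mat B" using s by simp
    then show ?thesis using w by (auto simp: diag_mat_def)
  qed
  finally show ?thesis .
qed

text \<open>By Schur triangularization and cyclicity of the trace it suffices to cube a triangular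
  matrix, whose diagonal is cubed entrywise.\<close>

lemma mat_trace_cube:
  fixes A :: "'a :: conjugatable_ordered_field mat"
  assumes A: "A \<in> carrier_mat n n" and es: "char_poly A = (\<Prod>e\<leftarrow>es. [:- e, 1:])"
  shows "mat_trace (A * A * A) = (\<Sum>e\<leftarrow>es. e ^ 3)"
proof -
  obtain B P Q where d: "schur_decomposition A es = (B, P, Q)" by (metis prod_cases3)
  note s = schur_decomposition[OF A es d]
  note w = similar_mat_witD2[OF A conjunct1[OF s]]
  have ut: "upper_triangular B" and diag: "es = diag_mat B" using s by auto
  have mult: "(P * X * Q) * (P * Y * Q) = P * (X * Y) * Q"
    if "X \<in> carrier_mat n n" "Y \<in> carrier_mat n n" for X Y
  proof -
    have c: "P \<in> carrier_mat n n" "Q \<in> carrier_mat n n" "X \<in> carrier_mat n n" "Y \<in> carrier_mat n n"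
      using w that by auto
    have "Q * (P * (Y * Q)) = (Q * P) * (Y * Q)"
      by (rule assoc_mult_mat[symmetric]) (use c in auto)
    also have "\<dots> = Y * Q" using w(2) c by simp
    finally have QP: "Q * (P * (Y * Q)) = Y * Q" .
    have "(P * X * Q) * (P * Y * Q) = P * (X * (Q * (P * (Y * Q))))"
      using c by (simp add: assoc_mult_mat[of _ n n _ n _ n])
    also have "\<dots> = P * (X * Y) * Q"
      unfolding QP using c by (simp add: assoc_mult_mat[of _ n n _ n _ n])
    finally show ?thesis .
  qed
  have "A * A * A = P * (B * B * B) * Q"
    using mult[of B B] mult[of "B * B" B] w by simp
  then have "mat_trace (A * A * A) = mat_trace (Q * (P * (B * B * B)))"
    using w by (simp add: mat_trace_comm[of _ n])
  also have "Q * (P * (B * B * B)) = B * B * B"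
  proof -
    have "Q * (P * (B * B * B)) = (Q * P) * (B * B * B)"
      by (rule assoc_mult_mat[symmetric, of _ n n _ n _ n]) (use w in auto)
    then show ?thesis using w by simp
  qed
  also have "mat_trace (B * B * B) = (\<Sum>i<n. (B $$ (i, i)) ^ 3)"
    using w ut unfolding mat_trace_def
    by (auto simp: upper_triangular_mult[of _ n] power3_eq_cube simp del: index_mult_mat(1) intro!: sum.cong)
  also have "\<dots> = (\<Sum>e\<leftarrow>es. e ^ 3)"
    using w by (simp add: diag diag_mat_def o_def sum_list_sum_nth atLeast0LessThan)
  finally show ?thesis .
qed

text \<open>Conjugation by the diagonal sign matrix \<open>D\<close> of \<open>S\<close> flips
  exactly the entries between \<open>S\<close> and its complement, hence all nonzero ones. So
  \<open>A\<close> is similar to \<open>- A\<close>.\<close>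

lemma bipartite_mat_eigenvalues_symmetric:
  fixes A :: "real mat"
  assumes A: "A \<in> carrier_mat n n"
    and sym: "\<And>i j. i < n \<Longrightarrow> j < n \<Longrightarrow> A $$ (i, j) = A $$ (j, i)"
    and bip: "\<And>i j. i < n \<Longrightarrow> j < n \<Longrightarrow> A $$ (i, j) \<noteq> 0 \<Longrightarrow> (i \<in> S) \<noteq> (j \<in> S)"
  shows "eigenvalues_symmetric A"
proof -
  obtain es where es: "char_poly A = (\<Prod>e\<leftarrow>es. [:- e, 1:])"
    using real_symmetric_char_poly_splits[OF A sym] by blast
  define s :: "nat \<Rightarrow> real" where "s i = (if i \<in> S then 1 else -1)" for i
  define D where "D = mat_diag n s"
  have D: "D \<in> carrier_mat n n" by (simp add: D_def)
  have DD: "D * D = 1\<^sub>m n"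
    unfolding D_def mat_diag_diag by (rule eq_matI) (auto simp: mat_diag_def s_def)
  have "D * (- A) * D = A"
  proof (rule eq_matI)
    fix i j assume ij: "i < dim_row A" "j < dim_col A"
    then have "(D * (- A) * D) $$ (i, j) = s i * (- A $$ (i, j)) * s j"
      using A unfolding D_def
      by (simp add: mat_diag_mult_right[of _ n n] mat_diag_mult_left[of "- A" n n])
    also have "\<dots> = A $$ (i, j)"
      using bip[of i j] ij A by (cases "A $$ (i, j) = 0") (auto simp: s_def)
    finally show "(D * (- A) * D) $$ (i, j) = A $$ (i, j)" .
  qed (use A D in auto)
  then have "similar_mat A (- A)"
    using A D DD by (intro similar_matI[of _ _ D D n]) auto
  then have "char_poly A = (\<Prod>e\<leftarrow>map uminus es. [:- e, 1:])"
    using char_poly_similar char_poly_uminus[OF A es] by metis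
  then have eq: "(\<Prod>e\<leftarrow>map uminus es. [:- e, 1:]) = (\<Prod>e\<leftarrow>es. [:- e, 1:])" using es by simp
  have "count (mset (map uminus es)) x = count (mset es) x" for x
    unfolding order_prod_linear_factors[symmetric] by (simp only: eq)
  then have "mset (map uminus es) = mset es" by (rule multiset_eqI)
  then show ?thesis using eigenvalues_symmetric_iff[OF es] by simp
qed

text \<open>Under symmetry the sum of the cubed eigenvalues equals its own negative. As a trace,
  however, it is a sum of nonnegative weights of closed 3-step walks, and the triangle
  \<open>i j k\<close> contributes a positive one.\<close>

lemma triangle_mat_not_eigenvalues_symmetric:
  fixes A :: "real mat"
  assumes A: "A \<in> carrier_mat n n"
    and sym: "\<And>i j. i < n \<Longrightarrow> j < n \<Longrightarrow> A $$ (i, j) = A $$ (j, i)"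
    and nonneg: "\<And>i j. i < n \<Longrightarrow> j < n \<Longrightarrow> A $$ (i, j) \<ge> 0"
    and ijk: "i < n" "j < n" "k < n" "A $$ (i, j) > 0" "A $$ (j, k) > 0" "A $$ (i, k) > 0"
  shows "\<not> eigenvalues_symmetric A"
proof
  assume es_sym: "eigenvalues_symmetric A"
  obtain es where es: "char_poly A = (\<Prod>e\<leftarrow>es. [:- e, 1:])"
    using real_symmetric_char_poly_splits[OF A sym] by blast
  let ?c = "\<lambda>e :: real. e ^ 3"
  have "(\<Sum>e\<leftarrow>es. ?c e) = sum_mset (image_mset ?c (mset es))"
    by (simp flip: sum_mset_sum_list)
  also have "mset es = image_mset uminus (mset es)"
    using es_sym eigenvalues_symmetric_iff[OF es] by simp
  also have "sum_mset (image_mset ?c (image_mset uminus (mset es))) = - (\<Sum>e\<leftarrow>es. ?c e)"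
    by (induction es) auto
  finally have "mat_trace (A * A * A) = 0" using mat_trace_cube[OF A es] by simp
  moreover have AA: "A * A \<in> carrier_mat n n" using A by simp
  have "mat_trace (A * A * A) = (\<Sum>i<n. \<Sum>k<n. (\<Sum>j<n. A $$ (i, j) * A $$ (j, k)) * A $$ (k, i))"
    unfolding mat_trace_def using A
    by (intro sum.cong) (auto simp: mat_mult_index_sum[OF AA A] mat_mult_index_sum[OF A A]
        simp del: index_mult_mat(1) assoc_mult_mat intro!: sum.cong)
  moreover have "\<dots> > 0"
  proof (rule sum_pos2[of _ i])
    show "0 < (\<Sum>k<n. (\<Sum>j<n. A $$ (i, j) * A $$ (j, k)) * A $$ (k, i))"
    proof (rule sum_pos2[of _ k])
      have "0 < (\<Sum>j<n. A $$ (i, j) * A $$ (j, k))"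
        using ijk nonneg by (intro sum_pos2[of _ j]) auto
      then show "0 < (\<Sum>j<n. A $$ (i, j) * A $$ (j, k)) * A $$ (k, i)"
        using ijk sym[of k i] by simp
    qed (use ijk nonneg in \<open>auto intro!: mult_nonneg_nonneg sum_nonneg\<close>)
  qed (use ijk nonneg in \<open>auto intro!: mult_nonneg_nonneg sum_nonneg\<close>)
  ultimately show False by simp
qed

section \<open>Blocks of graphs\<close>

lemma (in wf_digraph) reachable_iff_rtrancl:
  "u \<rightarrow>\<^sup>* v \<longleftrightarrow> u \<in> verts G \<and> (u, v) \<in> (arcs_ends G)\<^sup>*"
proof
  show "u \<rightarrow>\<^sup>* v" if "u \<in> verts G \<and> (u, v) \<in> (arcs_ends G)\<^sup>*"
    using conjunct2[OF that]
    by (induction rule: rtrancl_induct) (use that reachable_adj_trans in auto)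
qed (auto dest: reachable_rtranclI reachable_in_verts)

lemma (in wf_digraph) Restr_arcs_ends: "Restr (arcs_ends G) (verts G) = arcs_ends G"
  using adj_in_verts by auto

lemma (in wf_digraph) connected_on_iff_reachable:
  "connected_on (arcs_ends G) (verts G) \<longleftrightarrow> (\<forall>u\<in>verts G. \<forall>v\<in>verts G. u \<rightarrow>\<^sup>* v)"
  by (simp add: connected_on_def Restr_arcs_ends reachable_iff_rtrancl)

lemma arcs_ends_induce: "arcs_ends (G \<restriction> S) = Restr (arcs_ends G) S"
  by (auto simp: arcs_ends_conv)

lemma (in graph) graph_induce: "S \<subseteq> verts G \<Longrightarrow> graph (G \<restriction> S)"
proof -
  assume S: "S \<subseteq> verts G"
  interpret H: digraph "G \<restriction> S" by (rule digraph_subgraph[OF subgraph_induce_subgraphI[OF S]])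
  have "symmetric (G \<restriction> S)"
    using sym_arcs by (auto simp: symmetric_def arcs_ends_induce sym_def)
  then show ?thesis by (rule H.graphI)
qed

lemma (in wf_digraph) del_vert_eq_induce: "del_vert v = G \<restriction> (verts G - {v})"
  by (auto simp: del_vert_def induce_subgraph_def)

lemma (in graph) connected_iff:
  "Digraph_Component.connected G \<longleftrightarrow> verts G \<noteq> {} \<and> connected_on (arcs_ends G) (verts G)"
  by (simp add: connected_def strongly_connected_def reachable_mk_symmetric_eq[OF sym_arcs]
      connected_on_iff_reachable)

text \<open>The bound \<open>\<le> 1\<close> instead of equality also covers the graph without
  vertices, which arises by deleting the only vertex.\<close>

lemma (in graph) card_sccs_verts_le_1_iff:
  "card sccs_verts \<le> 1 \<longleftrightarrow> connected_on (arcs_ends G) (verts G)"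
proof
  assume "card sccs_verts \<le> 1"
  then have *: "S = T" if "S \<in> sccs_verts" "T \<in> sccs_verts" for S T
    using that card_le_Suc0_iff_eq[OF finite_sccs_verts] by auto
  have "u \<rightarrow>\<^sup>* v" if "u \<in> verts G" "v \<in> verts G" for u v
    using *[OF scc_of_in_sccs_verts[OF that(1)] scc_of_in_sccs_verts[OF that(2)]]
      in_scc_of_self[OF that(2)] by (auto simp: scc_of_def)
  then show "connected_on (arcs_ends G) (verts G)" by (simp add: connected_on_iff_reachable)
next
  assume "connected_on (arcs_ends G) (verts G)"
  then have "scc_of u = verts G" if "u \<in> verts G" for u
    using that reachable_in_verts(2)[of u] unfolding scc_of_def connected_on_iff_reachable by blast
  then have "sccs_verts \<subseteq> {verts G}" by (auto simp: sccs_verts_conv_scc_of)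
  then show "card sccs_verts \<le> 1" using card_mono[of "{verts G}" sccs_verts] by simp
qed

text \<open>A connected graph has exactly one component, so more components after deletion means at
  least two.\<close>

lemma (in graph) cut_vertex_iff:
  assumes "Digraph_Component.connected G"
  shows "cut_vertex G v \<longleftrightarrow> v \<in> verts G \<and> \<not> connected_on (arcs_ends G) (verts G - {v})"
proof -
  obtain u where u: "u \<in> verts G" using assms connected_iff by auto
  have "card sccs_verts \<noteq> 0"
    using scc_of_in_sccs_verts[OF u] finite_sccs_verts by auto
  moreover have "card sccs_verts \<le> 1"
    using assms connected_iff card_sccs_verts_le_1_iff by simp
  ultimately have "card sccs_verts = 1" by simp
  moreover have "graph (G \<restriction> (verts G - {v}))" by (rule graph_induce) auto
  then have "card (pre_digraph.sccs_verts (del_vert v)) \<le> 1 \<longleftrightarrow>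
      connected_on (arcs_ends G) (verts G - {v})"
    using graph.card_sccs_verts_le_1_iff[of "G \<restriction> (verts G - {v})"]
    by (simp add: del_vert_eq_induce arcs_ends_induce connected_on_Restr)
  ultimately show ?thesis by (auto simp: cut_vertex_def)
qed

lemma (in graph) nonseparable_iff:
  "verts G \<noteq> {} \<and> nonseparable (arcs_ends G) (verts G) \<longleftrightarrow>
     Digraph_Component.connected G \<and> (\<forall>v. \<not> cut_vertex G v)"
proof -
  have "connected_on (arcs_ends G) (verts G - {v})"
    if "connected_on (arcs_ends G) (verts G)" "v \<notin> verts G" for v
    using that by simp
  then have "connected_on (arcs_ends G) (verts G) \<Longrightarrow> (\<forall>v. connected_on (arcs_ends G) (verts G - {v})) \<longleftrightarrow>
      (\<forall>v\<in>verts G. connected_on (arcs_ends G) (verts G - {v}))" by blast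
  then show ?thesis
    unfolding nonseparable_def using cut_vertex_iff connected_iff by blast
qed

lemma (in graph) relpow_iff_awalk:
  "u \<in> verts G \<Longrightarrow> (u, v) \<in> arcs_ends G ^^ n \<longleftrightarrow> (\<exists>p. awalk u p v \<and> length p = n)"
proof (induction n arbitrary: u)
  case 0
  then show ?case by (auto simp: awalk_Nil_iff)
next
  case (Suc n)
  show ?case
  proof
    assume "(u, v) \<in> arcs_ends G ^^ Suc n"
    then obtain w where w: "(u, w) \<in> arcs_ends G" "(w, v) \<in> arcs_ends G ^^ n"
      by (meson relpow_Suc_D2)
    then obtain p where "awalk w p v" "length p = n"
      using Suc.IH[of w] adj_in_verts[OF w(1)] by auto
    moreover obtain e where "e \<in> arcs G" "tail G e = u" "head G e = w"
      using w(1) by (auto simp: arcs_ends_conv)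
    ultimately show "\<exists>p. awalk u p v \<and> length p = Suc n"
      by (intro exI[of _ "e # p"]) (auto simp: awalk_Cons_iff)
  next
    assume "\<exists>p. awalk u p v \<and> length p = Suc n"
    then obtain e p where p: "awalk u (e # p) v" "length p = n" by (auto simp: length_Suc_conv)
    then have "e \<in> arcs G" "tail G e = u" "awalk (head G e) p v" by (auto simp: awalk_Cons_iff)
    then have "(u, head G e) \<in> arcs_ends G" "(head G e, v) \<in> arcs_ends G ^^ n"
      using Suc.IH[of "head G e"] p(2) by (auto simp: arcs_ends_conv)
    then show "(u, v) \<in> arcs_ends G ^^ Suc n" by (rule relpow_Suc_I2)
  qed
qed

lemma (in graph) gdist_eq_rel_dist: "u \<in> verts G \<Longrightarrow> gdist G u v = rel_dist (arcs_ends G) u v"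
  unfolding gdist_def rel_dist_def Inf_nat_def
  by (intro arg_cong[where f = Least]) (auto simp: relpow_iff_awalk)

locale connected_graph = graph +
  assumes connected: "Digraph_Component.connected G"
begin

sublocale connected_rel "verts G" "arcs_ends G"
proof
  show "arcs_ends G \<subseteq> verts G \<times> verts G" using adj_in_verts by auto
  show "sym (arcs_ends G)" using sym_arcs by (simp add: symmetric_def)
  show "(x, x) \<notin> arcs_ends G" for x using adj_not_same by blast
  show "connected_on (arcs_ends G) (verts G)" using connected connected_iff by simp
qed simp

text \<open>A larger candidate \<open>H\<close> may miss arcs of \<open>G\<close> between its
  vertices, but adding arcs preserves nonseparability. So its vertex set is \<open>S\<close>, and
  its arcs are squeezed between those of the induced subgraph.\<close>

lemma is_block_induce:
  assumes "is_max_nonsep S"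
  shows "is_block G (G \<restriction> S)"
proof -
  have S: "S \<noteq> {}" "S \<subseteq> verts G" "nonseparable (arcs_ends G) S"
    and max: "\<And>T. S \<subseteq> T \<Longrightarrow> T \<subseteq> verts G \<Longrightarrow> nonseparable (arcs_ends G) T \<Longrightarrow> T = S"
    using assms unfolding is_max_nonsep_def by blast+
  let ?P = "\<lambda>H. graph H \<and> Digraph_Component.connected H \<and> (\<forall>v. \<not> cut_vertex H v)"
  have "?P (G \<restriction> S)"
    using graph.nonseparable_iff[OF graph_induce[OF S(2)]] graph_induce[OF S(2)] S(1,3)
    by (simp add: arcs_ends_induce nonseparable_Restr)
  moreover have "H = G \<restriction> S" if H: "subgraph (G \<restriction> S) H" "subgraph H G" "?P H" for H
  proof -
    have "nonseparable (arcs_ends H) (verts H)"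
      using H(3) graph.nonseparable_iff[of H] by blast
    then have "nonseparable (arcs_ends G) (verts H)"
      using arcs_ends_mono[OF H(2)] by (rule nonseparable_mono)
    moreover have sub: "S \<subseteq> verts H" "verts H \<subseteq> verts G" using H(1,2) by (auto simp: subgraph_def)
    ultimately have V: "verts H = S" using max by blast
    have c: "tail H = tail G" "head H = head G" using H(2) by (auto simp: subgraph_def compatible_def)
    have wf: "wf_digraph H" using H(2) by (auto simp: subgraph_def)
    have "arcs H = arcs (G \<restriction> S)"
    proof
      show "arcs (G \<restriction> S) \<subseteq> arcs H" using H(1) by (auto simp: subgraph_def)
      show "arcs H \<subseteq> arcs (G \<restriction> S)"
        using H(2) wf_digraph.wellformed[OF wf] c V by (auto simp: subgraph_def)
    qed
    then show ?thesis using V c by (intro pre_digraph.equality) auto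
  qed
  ultimately show ?thesis
    unfolding is_block_def max_subgraph_def using subgraph_induce_subgraphI[OF S(2)] by blast
qed

text \<open>Deleting the gate separates \<open>w\<close> from the other block vertex
  \<open>b\<close>.\<close>

lemma gate_cut_vertex:
  assumes B: "is_max_nonsep B" and w: "w \<in> verts G - B" and b: "b \<in> B" "b \<noteq> gate B w"
  shows "cut_vertex G (gate B w)"
proof -
  have BV: "B \<subseteq> verts G" using B by (auto simp: is_max_nonsep_def)
  have g: "gate B w \<in> B" using gate_in[OF B] w by blast
  then have "w \<noteq> gate B w" using w by auto
  then have "\<not> connected_on (arcs_ends G) (verts G - {gate B w})"
    using gate_separates[OF B w b] w b BV unfolding connected_on_def by blast
  then show ?thesis using cut_vertex_iff[OF connected] g BV by blast
qed

text \<open>Both sides are nonempty, so two distinct vertices on one side are nonadjacent with a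
  common neighbour on the other.\<close>

lemma complete_bipartite_dist:
  assumes S: "S \<subseteq> verts G" and K: "complete_bipartite_digraph m n (G \<restriction> S)" "m \<ge> 1" "n \<ge> 1"
  shows "\<exists>\<sigma>. \<forall>a\<in>S. \<forall>b\<in>S. d a b = (if a = b then 0 else if \<sigma> a = (\<sigma> b :: bool) then 2 else 1)"
proof -
  obtain U W where UW: "S = U \<union> W" "U \<inter> W = {}" "card U = m" "card W = n"
    and R: "Restr (arcs_ends G) S = U \<times> W \<union> W \<times> U"
    using K(1) unfolding complete_bipartite_digraph_def arcs_ends_induce by auto
  have ne: "U \<noteq> {}" "W \<noteq> {}" using UW K(2,3) by auto
  have adj: "(a, b) \<in> arcs_ends G \<longleftrightarrow> (a \<in> U) \<noteq> (b \<in> U)" if "a \<in> S" "b \<in> S" for a b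
  proof -
    have "(a, b) \<in> arcs_ends G \<longleftrightarrow> (a, b) \<in> U \<times> W \<union> W \<times> U" using that R by blast
    then show ?thesis using that UW by auto
  qed
  have "d a b = (if a = b then 0 else if (a \<in> U) = (b \<in> U) then 2 else 1)"
    if ab: "a \<in> S" "b \<in> S" for a b
  proof -
    have V: "a \<in> verts G" "b \<in> verts G" using ab S by auto
    consider "a = b" | "(a \<in> U) \<noteq> (b \<in> U)" | "a \<noteq> b" "(a \<in> U) = (b \<in> U)" by blast
    then show ?thesis
    proof cases
      case 2
      then have "d a b = 1" using adj[OF ab] dist_eq_1[OF V] by simp
      then show ?thesis using 2 by auto
    next
      case 3
      obtain c where c: "c \<in> S" "(c \<in> U) \<noteq> (a \<in> U)" using ne UW by blast
      have "(a, c) \<in> arcs_ends G" "(c, b) \<in> arcs_ends G" using adj ab c 3 by auto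
      then have "(a, b) \<in> arcs_ends G ^^ 2" by (auto simp: numeral_2_eq_2)
      then have "d a b \<le> 2" by (rule dist_le)
      moreover have "d a b \<noteq> 0" "d a b \<noteq> 1"
        using dist_eq_0[OF V] dist_eq_1[OF V] adj[OF ab] 3 by auto
      ultimately show ?thesis using 3 by auto
    qed simp
  qed
  then show ?thesis by (intro exI[of _ "\<lambda>a. a \<in> U"]) blast
qed

text \<open>Every edge extends to a block, and the gates of the vertices outside it are cut-vertices
  in it, of which the class allows at most two.\<close>

lemma gated_metric_class_B:
  assumes "class_B G"
  shows "gated_metric (verts G) d"
proof
  show "verts G \<noteq> {}" using connected connected_iff by simp
  show "d u v = d v u" if "u \<in> verts G" "v \<in> verts G" for u v using dist_commute that .
  show "d u v = 0 \<longleftrightarrow> u = v" if "u \<in> verts G" "v \<in> verts G" for u v using dist_eq_0 that .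
  show "d u w \<le> d u v + d v w" if "u \<in> verts G" "v \<in> verts G" "w \<in> verts G" for u v w
    using dist_triangle that .
  show "\<exists>x\<in>verts G. d u x = k \<and> d x v = d u v - k"
    if "u \<in> verts G" "v \<in> verts G" "k \<le> d u v" for u v k using dist_split that .
  fix x y assume xy: "x \<in> verts G" "y \<in> verts G" "d x y = 1"
  then have "(x, y) \<in> arcs_ends G" using dist_eq_1 by blast
  then obtain B where B: "is_max_nonsep B" "{x, y} \<subseteq> B"
    using max_nonsep_containing[OF nonseparable_edge] xy by blast
  have BV: "B \<subseteq> verts G" using B by (auto simp: is_max_nonsep_def)
  have bl: "is_block G (G \<restriction> B)" by (rule is_block_induce[OF B(1)])
  obtain m n where "complete_bipartite_digraph m n (G \<restriction> B)" "m \<ge> 1" "n \<ge> 1"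
    using assms bl unfolding class_B_def bi_block_graph_def by blast
  then obtain \<sigma> where \<sigma>: "\<forall>a\<in>B. \<forall>b\<in>B. d a b = (if a = b then 0 else if \<sigma> a = (\<sigma> b :: bool) then 2 else 1)"
    using complete_bipartite_dist[OF BV] by blast
  have "gate B ` (verts G - B) \<subseteq> {v \<in> B. cut_vertex G v}"
  proof
    fix p assume "p \<in> gate B ` (verts G - B)"
    then obtain w where w: "p = gate B w" "w \<in> verts G - B" by blast
    \<comment> \<open>The block contains both ends of an edge, hence a vertex other than the gate,
      as \<open>gate_cut_vertex\<close> requires.\<close>
    have "x \<noteq> y" using xy by auto
    then obtain b where "b \<in> B" "b \<noteq> gate B w" using B(2) by blast
    then show "p \<in> {v \<in> B. cut_vertex G v}"
      using gate_cut_vertex[OF B(1) w(2)] gate_in[OF B(1)] w by blast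
  qed
  moreover have "card {v \<in> B. cut_vertex G v} \<le> 2"
    using assms bl unfolding class_B_def by (metis induce_subgraph_verts)
  moreover have "finite {v \<in> B. cut_vertex G v}" using BV finite_V by (simp add: finite_subset)
  ultimately have "card (gate B ` (verts G - B)) \<le> 2" by (meson card_mono le_trans)
  then have "gated_block (verts G) d B \<sigma> (gate B)"
    unfolding gated_block_def
    using BV \<sigma> gate_in[OF B(1)] gate_in_block[OF B(1)] dist_through_gates[OF B(1)] by blast
  then show "\<exists>B \<sigma> g. x \<in> B \<and> y \<in> B \<and> gated_block (verts G) d B \<sigma> g" using B(2) by blast
qed simp

end

theorem theorem4p7:
  fixes G :: "('a, 'b) pre_digraph" and vs :: "'a list"
  assumes "class_B G"
    and "diam G \<ge> 4"
    and "distinct vs" and "set vs = verts G"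
  shows "eigenvalues_symmetric (ecc_matrix G vs) \<longleftrightarrow> odd (diam G)"
proof -
  have "graph G" "Digraph_Component.connected G"
    using assms(1) by (auto simp: class_B_def bi_block_graph_def)
  then interpret connected_graph G
    by (intro connected_graph.intro connected_graph_axioms.intro)
  interpret gated_metric "verts G" d by (rule gated_metric_class_B[OF assms(1)])
  \<comment> \<open>The maxima run over \<open>verts G\<close>, where \<open>gdist\<close> and
    \<open>d\<close> agree.\<close>
  have ecc: "eccentricity G u = ecc u" if "u \<in> verts G" for u
    unfolding eccentricity_def ecc_def using that
    by (intro arg_cong[where f = Max] image_cong) (auto simp: gdist_eq_rel_dist)
  have dia: "diam G = dia"
    unfolding diam_def dia_def by (intro arg_cong[where f = Max] image_cong) (auto simp: ecc)
  let ?n = "length vs" and ?A = "ecc_matrix G vs"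
  have A: "?A \<in> carrier_mat ?n ?n" by (simp add: ecc_matrix_def)
  have V: "vs ! i \<in> verts G" if "i < ?n" for i using that assms(4) nth_mem by blast
  have entry: "?A $$ (i, j) = (if d (vs ! i) (vs ! j) = min (ecc (vs ! i)) (ecc (vs ! j))
      then real (d (vs ! i) (vs ! j)) else 0)" if "i < ?n" "j < ?n" for i j
    using that V by (simp add: ecc_matrix_def gdist_eq_rel_dist ecc)
  have sym: "?A $$ (i, j) = ?A $$ (j, i)" if "i < ?n" "j < ?n" for i j
    using that V[OF that(1)] V[OF that(2)] by (simp add: entry d_commute min.commute)
  have four: "dia \<ge> 4" using assms(2) dia by simp
  show ?thesis
  proof (cases "odd dia")
    case True
    obtain S where S: "\<forall>w\<in>verts G. \<forall>w'\<in>verts G.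
        d w w' = min (ecc w) (ecc w') \<longrightarrow> (w \<in> S) \<noteq> (w' \<in> S)"
      using odd_dia_bipartition[OF True four] ..
    have "eigenvalues_symmetric ?A"
    proof (rule bipartite_mat_eigenvalues_symmetric[OF A sym])
      fix i j assume ij: "i < ?n" "j < ?n" "?A $$ (i, j) \<noteq> 0"
      then show "(i \<in> {i. vs ! i \<in> S}) \<noteq> (j \<in> {i. vs ! i \<in> S})"
        using S[rule_format, OF V V, of i j] by (auto simp: entry split: if_splits)
    qed
    then show ?thesis using True dia by simp
  next
    case False
    then have "even dia" by simp
    from even_dia_triangle[OF this four] obtain u v x where
      uvx: "u \<in> verts G" "v \<in> verts G" "x \<in> verts G" and
      e: "d u v = min (ecc u) (ecc v)" "d v x = min (ecc v) (ecc x)" "d u x = min (ecc u) (ecc x)"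
        "d u v > 0" "d v x > 0" "d u x > 0" by blast
    obtain i j k where ijk: "i < ?n" "j < ?n" "k < ?n" "vs ! i = u" "vs ! j = v" "vs ! k = x"
      using uvx unfolding assms(4)[symmetric] in_set_conv_nth by blast
    have "\<not> eigenvalues_symmetric ?A"
    proof (rule triangle_mat_not_eigenvalues_symmetric[OF A sym _ ijk(1,2,3)])
      show "?A $$ (i, j) \<ge> 0" if "i < ?n" "j < ?n" for i j using that by (simp add: entry)
      show "?A $$ (i, j) > 0" "?A $$ (j, k) > 0" "?A $$ (i, k) > 0"
        using ijk e by (simp_all add: entry)
    qed
    then show ?thesis using False dia by simp
  qed
qed

end
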